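(* Let $k,m\ge 1$ be integers such that $p:=\frac{2k}{m}$ is not an even integer and $p>2$. Let $f_k:\mathbb{C}^2\to\mathbb{C}^2$, $f_k(z_1,z_2)=(z_1,z_1^kz_2)$, let $\mathbb{B}$ be the unit ball in $\mathbb{C}^2$, $\mathbb{B}'=\mathbb{B}\setminus\{z_1=0\}$, $\Delta$ the unit disc in $\mathbb{C}$ and $\Delta^*=\Delta\setminus\{0\}$. Set $$D_1=\mathbb{B}\times f_k(\Delta^*\times\Delta),\qquad D_2=f_k(\mathbb{B}')\times\Delta^2 .$$ Then $D_1$ and $D_2$ are $A^p$-complete bounded domains in $\mathbb{C}^4$, there is a linear isometry between $A^p(D_1)$ and $A^p(D_2)$, and $D_1$ and $D_2$ are not biholomorphic.
   Context: For a bounded domain $D\subset\mathbb{C}^n$ and $p>0$, $A^p(D)$ denotes the space of holomorphic functions $\phi$ on $D$ with $\|\phi\|_p:=\left(\int_D|\phi|^p\,d\lambda_n\right)^{1/p}<\infty$, where $d\lambda_n$ is Lebesgue measure on $\mathbb{C}^n$ (the same notation is used for any domain in $\mathbb{C}^n$). A linear isometry $T:A^p(D_1)\to A^p(D_2)$ is a linear isomorphism (in particular a bijection) with $\|T\phi\|_p=\|\phi\|_p$ for all $\phi\in A^p(D_1)$. A bounded domain $D\subset\mathbb{C}^n$ is $A^p$-complete if there does not exist a domain $\tilde D\subset\mathbb{C}^n$ with $D\subsetneqq\tilde D$ such that the restriction map $A^p(\tilde D)\to A^p(D)$ is a linear isometry. *)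

theory Defs
  imports "HOL-Analysis.Analysis"
begin

definition domain_Cn :: "(complex ^ 'n) set \<Rightarrow> bool" where
  "domain_Cn D \<longleftrightarrow> open D \<and> connected D \<and> D \<noteq> {}"

definition bounded_domain_Cn :: "(complex ^ 'n) set \<Rightarrow> bool" where
  "bounded_domain_Cn D \<longleftrightarrow> domain_Cn D \<and> bounded D"

(* Several complex variables: real Frechet differentiability with complex-linear derivative.
   Only meaningful for open D. *)
definition holo_fun_on :: "(complex ^ 'n \<Rightarrow> complex) \<Rightarrow> (complex ^ 'n) set \<Rightarrow> bool" where
  "holo_fun_on f D \<longleftrightarrow>
     (\<forall>z\<in>D. \<exists>f'. (f has_derivative f') (at z) \<and> (\<forall>c v. f' (c *s v) = c * f' v))"

definition holo_map_on :: "(complex ^ 'n \<Rightarrow> complex ^ 'm) \<Rightarrow> (complex ^ 'n) set \<Rightarrow> bool" where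
  "holo_map_on F D \<longleftrightarrow> (\<forall>i. holo_fun_on (\<lambda>z. F z $ i) D)"

definition biholomorphic :: "(complex ^ 'n) set \<Rightarrow> (complex ^ 'm) set \<Rightarrow> bool" where
  "biholomorphic D E \<longleftrightarrow>
     (\<exists>F G. holo_map_on F D \<and> holo_map_on G E \<and> F ` D \<subseteq> E \<and> G ` E \<subseteq> D \<and>
            (\<forall>z\<in>D. G (F z) = z) \<and> (\<forall>w\<in>E. F (G w) = w))"

(* A function on D is represented by its extension by 0 to all of C^n, so that
   functions on D which agree on D are equal. *)
definition Ap :: "real \<Rightarrow> (complex ^ 'n) set \<Rightarrow> (complex ^ 'n \<Rightarrow> complex) set" where
  "Ap p D = {\<phi>. holo_fun_on \<phi> D \<and> (\<forall>z. z \<notin> D \<longrightarrow> \<phi> z = 0) \<and>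
                set_integrable lebesgue D (\<lambda>z. norm (\<phi> z) powr p)}"

definition Ap_norm :: "real \<Rightarrow> (complex ^ 'n) set \<Rightarrow> (complex ^ 'n \<Rightarrow> complex) \<Rightarrow> real" where
  "Ap_norm p D \<phi> = (LINT z:D|lebesgue. norm (\<phi> z) powr p) powr (1 / p)"

definition Ap_isometry ::
  "real \<Rightarrow> (complex ^ 'n) set \<Rightarrow> (complex ^ 'm) set \<Rightarrow>
   ((complex ^ 'n \<Rightarrow> complex) \<Rightarrow> (complex ^ 'm \<Rightarrow> complex)) \<Rightarrow> bool" where
  "Ap_isometry p D E T \<longleftrightarrow>
     bij_betw T (Ap p D) (Ap p E) \<and>
     (\<forall>\<phi>\<in>Ap p D. \<forall>\<psi>\<in>Ap p D. T (\<lambda>z. \<phi> z + \<psi> z) = (\<lambda>w. T \<phi> w + T \<psi> w)) \<and>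
     (\<forall>c. \<forall>\<phi>\<in>Ap p D. T (\<lambda>z. c * \<phi> z) = (\<lambda>w. c * T \<phi> w)) \<and>
     (\<forall>\<phi>\<in>Ap p D. Ap_norm p E (T \<phi>) = Ap_norm p D \<phi>)"

definition restrict0 :: "(complex ^ 'n) set \<Rightarrow> (complex ^ 'n \<Rightarrow> complex) \<Rightarrow> complex ^ 'n \<Rightarrow> complex" where
  "restrict0 D \<phi> = (\<lambda>z. if z \<in> D then \<phi> z else 0)"

(* The larger domain E is not required to be bounded. *)
definition Ap_complete :: "real \<Rightarrow> (complex ^ 'n) set \<Rightarrow> bool" where
  "Ap_complete p D \<longleftrightarrow>
     \<not> (\<exists>E. domain_Cn E \<and> D \<subset> E \<and> Ap_isometry p E D (restrict0 D))"

definition fmap :: "nat \<Rightarrow> complex ^ 2 \<Rightarrow> complex ^ 2" where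
  "fmap k z = vector [z $ 1, (z $ 1) ^ k * z $ 2]"

definition times2 :: "complex set \<Rightarrow> complex set \<Rightarrow> (complex ^ 2) set" where
  "times2 A B = {z. z $ 1 \<in> A \<and> z $ 2 \<in> B}"

(* A \<times> B under the identification of C^2 \<times> C^2 with C^4. *)
definition times4 :: "(complex ^ 2) set \<Rightarrow> (complex ^ 2) set \<Rightarrow> (complex ^ 4) set" where
  "times4 A B = {z. vector [z $ 1, z $ 2] \<in> A \<and> vector [z $ 3, z $ 4] \<in> B}"

abbreviation unit_disc :: "complex set" where
  "unit_disc \<equiv> ball 0 1"

(* The norm on complex ^ 2 is the Euclidean one. *)
abbreviation unit_ball2 :: "(complex ^ 2) set" where
  "unit_ball2 \<equiv> ball 0 1"

definition D1 :: "nat \<Rightarrow> (complex ^ 4) set" where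
  "D1 k = times4 unit_ball2 (fmap k ` times2 (unit_disc - {0}) unit_disc)"

definition D2 :: "nat \<Rightarrow> (complex ^ 4) set" where
  "D2 k = times4 (fmap k ` (unit_ball2 - {z. z $ 1 = 0})) (times2 unit_disc unit_disc)"

end

(* On the shear f(z1, z2) = (z1, z1^k z2) the pull-back phi o f is weighted by the Jacobian power
   |z1|^(2k) = |z1^m|^p, so phi |-> (phi o f) z1^m preserves p-th power norms; since p > 2, L^p holomorphic
   functions extend across {z1 = 0}.  Hence both A^p(D1) and A^p(D2) are isometric to A^p(B x Disc^2).
   Completeness: both domains are the interior of their closure, and if A^p(E) restricts isometrically
   onto A^p(D), the preimage of the constant 1 is 1 on D and vanishes a.e. on E - D; being
   continuous on the connected E it forces E into the closure of D.
   Non-equivalence: a biholomorphic map extends, by boundedness, to an automorphism of B x Disc^2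
   carrying the slice {z3 = 0} = B x Disc onto {z1 = 0} = Disc^3.  After a Moebius change of
   coordinates fixing 0, Schwarz' lemma makes its derivative at 0 a linear isometry between the norms
   max(|x1|, |x2|, |x3|) and max(|(y1, y2)|, |y3|); averaging over signs shows that there is none. *)

theory Submission
  imports Defs "HOL-Complex_Analysis.Riemann_Mapping"
begin

section \<open>Coordinatewise Lebesgue integration\<close>

text \<open>The exponent 2 is the threshold because |z|^(-p) is integrable near 0 in the plane
  exactly for p < 2: for p > 2 even a simple pole is excluded. Holomorphy is given only as pointwise
  Frechet differentiability with complex-linear derivative. The extension across a hyperplane is
  therefore a Cauchy integral in one coordinate, and its holomorphy in all variables needs a
  separate argument on parameter integrals. Extending a bounded biholomorphic map gives values on
  the hyperplane that a priori lie only in the closure of B x Disc^2. Strict inequalities come from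
  the maximum principle for complex-linear functionals of the map. The coordinatewise Moebius map
  moves 0 to the image of 0 but preserves only the polydisc, not B x Disc^2. That suffices, since
  the image of 0 lies on {z1 = 0}, where the two sets agree. The comparison of norms is thus made on
  that slice only: an upper bound for the derivative on the polydisc in three variables and a lower
  bound on its three basis vectors.\<close>

lemma lborel_distr_basis_permutation:
  fixes T :: "'a::euclidean_space \<Rightarrow> 'b::euclidean_space"
  assumes meas: "T \<in> borel_measurable borel"
    and bij: "bij_betw \<pi> Basis Basis"
    and T: "\<And>x b. b \<in> Basis \<Longrightarrow> T x \<bullet> \<pi> b = x \<bullet> b"
  shows "distr lborel borel T = lborel"
proof (rule lborel_eqI[symmetric])
  fix l u :: 'b assume le: "\<And>b. b \<in> Basis \<Longrightarrow> l \<bullet> b \<le> u \<bullet> b"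
  \<comment> \<open>Transpose of the permutation on coordinates; the preimage of a box under
    \<open>T\<close> is the box with the pulled back corners, and its side lengths are the old ones
    permuted.\<close>
  define pull :: "'b \<Rightarrow> 'a" where "pull y = (\<Sum>b\<in>Basis. (y \<bullet> \<pi> b) *\<^sub>R b)" for y
  have pull: "pull y \<bullet> b = y \<bullet> \<pi> b" if "b \<in> Basis" for y b
    unfolding pull_def using that by (simp add: inner_sum_left_Basis)
  have im: "\<pi> ` Basis = Basis" using bij by (simp add: bij_betw_def)
  have "T -` box l u = box (pull l) (pull u)"
  proof -
    have "(T x \<in> box l u) = (x \<in> box (pull l) (pull u))" for x
    proof -
      have "(T x \<in> box l u) = (\<forall>c\<in>\<pi> ` Basis. l \<bullet> c < T x \<bullet> c \<and> T x \<bullet> c < u \<bullet> c)"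
        unfolding im by (simp add: mem_box)
      also have "\<dots> = (\<forall>b\<in>Basis. pull l \<bullet> b < x \<bullet> b \<and> x \<bullet> b < pull u \<bullet> b)"
        by (simp add: T pull)
      finally show ?thesis by (simp add: mem_box)
    qed
    then show ?thesis by auto
  qed
  moreover have "pull l \<bullet> b \<le> pull u \<bullet> b" if "b \<in> Basis" for b
    using le[of "\<pi> b"] bij that by (auto simp: pull bij_betw_def)
  then have "emeasure lborel (box (pull l) (pull u)) = ennreal (\<Prod>b\<in>Basis. (pull u - pull l) \<bullet> b)"
    by (rule emeasure_lborel_box)
  moreover have "(\<Prod>b\<in>Basis. (pull u - pull l) \<bullet> b) = (\<Prod>b\<in>Basis. (u - l) \<bullet> \<pi> b)"
    by (intro prod.cong) (auto simp: inner_diff_left pull)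
  moreover have "\<dots> = (\<Prod>c\<in>Basis. (u - l) \<bullet> c)"
    by (rule prod.reindex_bij_betw[OF bij])
  ultimately show "emeasure (distr lborel borel T) (box l u) = (\<Prod>b\<in>Basis. (u - l) \<bullet> b)"
    using meas by (simp add: emeasure_distr)
qed simp

text \<open>The map from pairs of reals to \<open>Complex\<close> carries the standard basis to the
  standard basis, so it preserves Lebesgue measure and Fubini on the product of two lines
  applies.\<close>

lemma nn_integral_complex_eq_iterated:
  fixes h :: "complex \<Rightarrow> ennreal"
  assumes [measurable]: "h \<in> borel_measurable borel"
  shows "(\<integral>\<^sup>+z. h z \<partial>lborel) = (\<integral>\<^sup>+x. \<integral>\<^sup>+y. h (Complex x y) \<partial>lborel \<partial>lborel)"
proof -
  define T :: "real \<times> real \<Rightarrow> complex" where "T = (\<lambda>q. Complex (fst q) (snd q))"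
  have Teq: "T = (\<lambda>q. of_real (fst q) + \<i> * of_real (snd q))"
    by (auto simp: T_def complex_eq_iff)
  have T: "T \<in> borel_measurable borel"
    unfolding Teq by (intro borel_measurable_continuous_onI continuous_intros)
  have Basis: "(Basis :: (real \<times> real) set) = {(1, 0), (0, 1)}"
    by (auto simp: Basis_prod_def)
  have "inj_on T Basis"
    by (rule inj_onI) (simp add: T_def prod_eq_iff)
  moreover have "T ` Basis = Basis"
    unfolding Basis Basis_complex_def by (simp add: T_def one_complex.code imaginary_unit.code)
  ultimately have bij: "bij_betw T Basis Basis"
    by (simp add: bij_betw_def)
  have dot: "T x \<bullet> T b = x \<bullet> b" for x b
    by (simp add: T_def inner_complex_def inner_prod_def)
  have "distr lborel borel T = lborel"
    by (rule lborel_distr_basis_permutation[OF T bij dot])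
  then have "(\<integral>\<^sup>+z. h z \<partial>lborel) = (\<integral>\<^sup>+z. h z \<partial>distr lborel borel T)"
    by simp
  also have "\<dots> = (\<integral>\<^sup>+q. h (T q) \<partial>lborel)"
    by (rule nn_integral_distr) (use T in simp_all)
  also have "\<dots> = (\<integral>\<^sup>+q. h (T q) \<partial>(lborel \<Otimes>\<^sub>M lborel))"
    by (simp only: lborel_prod)
  also have "\<dots> = (\<integral>\<^sup>+x. \<integral>\<^sup>+y. h (T (x, y)) \<partial>lborel \<partial>lborel)"
  proof (rule lborel.nn_integral_fst[symmetric])
    have "(\<lambda>q. h (T q)) \<in> borel_measurable borel"
      using T assms by (rule measurable_compose)
    then show "(\<lambda>q. h (T q)) \<in> borel_measurable (lborel \<Otimes>\<^sub>M lborel)"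
      by (simp add: lborel_prod)
  qed
  finally show ?thesis by (simp add: T_def)
qed

section \<open>Area scaling under multiplication by a complex constant\<close>

lemma measurable_Complex [measurable (raw)]:
  assumes [measurable]: "f \<in> borel_measurable M" "g \<in> borel_measurable M"
  shows "(\<lambda>x. Complex (f x) (g x)) \<in> borel_measurable M"
proof -
  have "(\<lambda>x. Complex (f x) (g x)) = (\<lambda>x. of_real (f x) + \<i> * of_real (g x))"
    by (auto simp: complex_eq_iff)
  then show ?thesis by simp
qed

text \<open>With c = a + ib the map is (x, y) to (ax - by, bx + ay). It is split into two
  one-dimensional affine substitutions: s = ax - by for fixed y, then t = (b/a)s + dy for fixed s.
  Their factors a and d = (a^2 + b^2)/a multiply to |c|^2. Dividing by a is the reason for the
  condition on \<open>Re c\<close>.\<close>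

lemma nn_integral_complex_mult_Re_nonzero:
  fixes h :: "complex \<Rightarrow> ennreal"
  assumes [measurable]: "h \<in> borel_measurable borel" and a: "Re c \<noteq> 0"
  shows "ennreal ((cmod c)\<^sup>2) * (\<integral>\<^sup>+z. h (c * z) \<partial>lborel) = (\<integral>\<^sup>+z. h z \<partial>lborel)"
proof -
  define a b where "a = Re c" and "b = Im c"
  define d where "d = (a\<^sup>2 + b\<^sup>2) / a"
  have a0: "a \<noteq> 0" using a by (simp add: a_def)
  have ab: "a\<^sup>2 + b\<^sup>2 > 0" using a0 by (simp add: sum_power2_gt_zero_iff)
  then have d0: "d \<noteq> 0" using a0 by (auto simp: d_def)
  have c: "c = Complex a b" by (simp add: a_def b_def)
  have "(\<integral>\<^sup>+z. h (c * z) \<partial>lborel) = (\<integral>\<^sup>+x. \<integral>\<^sup>+y. h (Complex (a * x - b * y) (b * x + a * y)) \<partial>lborel \<partial>lborel)"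
    by (subst nn_integral_complex_eq_iterated) (auto simp: c complex_mult add.commute)
  also have "\<dots> = (\<integral>\<^sup>+y. \<integral>\<^sup>+x. h (Complex (a * x - b * y) (b * x + a * y)) \<partial>lborel \<partial>lborel)"
    by (rule lborel_pair.Fubini') (simp add: case_prod_beta)
  also have "\<dots> = (\<integral>\<^sup>+y. ennreal \<bar>1 / a\<bar> * (\<integral>\<^sup>+s. h (Complex s (b / a * s + d * y)) \<partial>lborel) \<partial>lborel)"
  proof (intro nn_integral_cong)
    fix y
    have eq: "b * (b * y / a + 1 / a * s) + a * y = b / a * s + d * y" for s
      unfolding d_def using a0 by (simp add: field_simps power2_eq_square)
    have "(\<integral>\<^sup>+x. h (Complex (a * x - b * y) (b * x + a * y)) \<partial>lborel)
        = \<bar>1 / a\<bar> * (\<integral>\<^sup>+s. h (Complex (a * (b * y / a + 1 / a * s) - b * y) (b * (b * y / a + 1 / a * s) + a * y)) \<partial>lborel)"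
      by (rule nn_integral_real_affine) (use a0 in auto)
    also have "\<dots> = \<bar>1 / a\<bar> * (\<integral>\<^sup>+s. h (Complex s (b / a * s + d * y)) \<partial>lborel)"
      unfolding eq using a0 by (simp add: field_simps)
    finally show "(\<integral>\<^sup>+x. h (Complex (a * x - b * y) (b * x + a * y)) \<partial>lborel) = \<dots>" .
  qed
  also have "\<dots> = ennreal \<bar>1 / a\<bar> * (\<integral>\<^sup>+y. \<integral>\<^sup>+s. h (Complex s (b / a * s + d * y)) \<partial>lborel \<partial>lborel)"
    by (rule nn_integral_cmult) measurable
  also have "(\<integral>\<^sup>+y. \<integral>\<^sup>+s. h (Complex s (b / a * s + d * y)) \<partial>lborel \<partial>lborel)
           = (\<integral>\<^sup>+s. \<integral>\<^sup>+y. h (Complex s (b / a * s + d * y)) \<partial>lborel \<partial>lborel)"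
    by (rule lborel_pair.Fubini') (simp add: case_prod_beta)
  also have "\<dots> = (\<integral>\<^sup>+s. ennreal \<bar>1 / d\<bar> * (\<integral>\<^sup>+t. h (Complex s t) \<partial>lborel) \<partial>lborel)"
  proof (intro nn_integral_cong)
    fix s
    have "(\<integral>\<^sup>+y. h (Complex s (b / a * s + d * y)) \<partial>lborel)
        = \<bar>1 / d\<bar> * (\<integral>\<^sup>+t. h (Complex s (b / a * s + d * (- (b / a * s / d) + 1 / d * t))) \<partial>lborel)"
      by (rule nn_integral_real_affine) (use d0 in auto)
    also have "(\<lambda>t. b / a * s + d * (- (b / a * s / d) + 1 / d * t)) = (\<lambda>t. t)"
      using d0 by (simp add: field_simps)
    finally show "(\<integral>\<^sup>+y. h (Complex s (b / a * s + d * y)) \<partial>lborel) = \<bar>1 / d\<bar> * (\<integral>\<^sup>+t. h (Complex s t) \<partial>lborel)"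
      by (metis (no_types))
  qed
  also have "\<dots> = ennreal \<bar>1 / d\<bar> * (\<integral>\<^sup>+s. \<integral>\<^sup>+t. h (Complex s t) \<partial>lborel \<partial>lborel)"
    by (rule nn_integral_cmult) measurable
  finally have eq: "(\<integral>\<^sup>+z. h (c * z) \<partial>lborel)
     = ennreal \<bar>1 / a\<bar> * (ennreal \<bar>1 / d\<bar> * (\<integral>\<^sup>+z. h z \<partial>lborel))"
    by (simp add: nn_integral_complex_eq_iterated)
  have "(cmod c)\<^sup>2 * (\<bar>1 / a\<bar> * \<bar>1 / d\<bar>) = 1"
    using a0 d0 ab unfolding d_def by (simp add: c cmod_power2 abs_mult abs_divide)
  moreover have "ennreal ((cmod c)\<^sup>2) * (ennreal \<bar>1 / a\<bar> * (ennreal \<bar>1 / d\<bar> * I))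
      = ennreal ((cmod c)\<^sup>2 * (\<bar>1 / a\<bar> * \<bar>1 / d\<bar>)) * I" for I
    by (simp only: ennreal_mult zero_le_power2 abs_ge_zero mult_nonneg_nonneg mult.assoc)
  ultimately show ?thesis
    by (simp only: eq ennreal_1 mult_1_left)
qed

lemma nn_integral_complex_mult:
  fixes h :: "complex \<Rightarrow> ennreal"
  assumes [measurable]: "h \<in> borel_measurable borel" and c: "c \<noteq> 0"
  shows "ennreal ((cmod c)\<^sup>2) * (\<integral>\<^sup>+z. h (c * z) \<partial>lborel) = (\<integral>\<^sup>+z. h z \<partial>lborel)"
proof (cases "Re c = 0")
  case True
  \<comment> \<open>For purely imaginary c = ib the quotient by 1 + \<i> is (b + ib)/2, so both
    factors of c = (1 + \<i>)e have nonzero real part.\<close>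
  define e where "e = c / (1 + \<i>)"
  have ne: "1 + \<i> \<noteq> (0::complex)" by (simp add: complex_eq_iff)
  have Re: "Re e \<noteq> 0" using True c by (auto simp: e_def Re_divide complex_eq_iff)
  have ce: "c = (1 + \<i>) * e" using ne by (simp add: e_def)
  have n: "(cmod c)\<^sup>2 = (cmod e)\<^sup>2 * (cmod (1 + \<i>))\<^sup>2" by (simp add: ce norm_mult power_mult_distrib)
  have "(\<integral>\<^sup>+z. h z \<partial>lborel) = ennreal ((cmod (1 + \<i>))\<^sup>2) * (\<integral>\<^sup>+z. h ((1 + \<i>) * z) \<partial>lborel)"
    by (rule nn_integral_complex_mult_Re_nonzero[symmetric]) auto
  also have "(\<integral>\<^sup>+z. h ((1 + \<i>) * z) \<partial>lborel) = ennreal ((cmod e)\<^sup>2) * (\<integral>\<^sup>+z. h ((1 + \<i>) * (e * z)) \<partial>lborel)"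
    by (rule nn_integral_complex_mult_Re_nonzero[symmetric]) (use Re in auto)
  finally show ?thesis
    unfolding n by (simp add: ennreal_mult ce mult_ac)
qed (rule nn_integral_complex_mult_Re_nonzero[OF assms(1)])

section \<open>Coordinate slices and Fubini in a single coordinate\<close>

definition upd :: "complex ^ 'n \<Rightarrow> 'n \<Rightarrow> complex \<Rightarrow> complex ^ 'n" where
  "upd z i \<zeta> = (\<chi> l. if l = i then \<zeta> else z $ l)"

lemma upd_nth [simp]: "upd z i \<zeta> $ l = (if l = i then \<zeta> else z $ l)"
  by (simp add: upd_def)

lemma upd_id [simp]: "upd z i (z $ i) = z"
  by (simp add: vec_eq_iff)

lemma upd_upd [simp]: "upd (upd z i a) i b = upd z i b"
  by (simp add: vec_eq_iff)

lemma upd_eq_add: "upd z i \<zeta> = z + axis i (\<zeta> - z $ i)"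
  by (simp add: vec_eq_iff axis_def)

lemma continuous_on_upd [continuous_intros]:
  assumes "continuous_on S f" "continuous_on S g"
  shows "continuous_on S (\<lambda>x. upd (f x) i (g x))"
  unfolding upd_def
proof (rule continuous_on_vec_lambda)
  show "continuous_on S (\<lambda>x. if l = i then g x else f x $ l)" for l
    using assms by (cases "l = i") (auto intro!: continuous_intros)
qed

lemma measurable_upd [measurable (raw)]:
  assumes f: "f \<in> borel_measurable M" and g: "g \<in> borel_measurable M"
  shows "(\<lambda>x. upd (f x) i (g x) :: complex^'n) \<in> borel_measurable M"
proof -
  have "(\<lambda>q. upd (fst q) i (snd q) :: complex^'n) \<in> borel_measurable borel"
    by (intro borel_measurable_continuous_onI continuous_intros)
  then have "(\<lambda>q. upd (fst q) i (snd q) :: complex^'n) \<in> borel_measurable (borel \<Otimes>\<^sub>M borel)"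
    by (simp add: borel_prod)
  from measurable_compose[OF measurable_Pair[OF f g] this] show ?thesis by simp
qed

lemma measurable_vec_nth_complex [measurable (raw)]:
  fixes f :: "'a \<Rightarrow> complex ^ 'n"
  assumes "f \<in> borel_measurable M"
  shows "(\<lambda>x. f x $ i) \<in> borel_measurable M"
proof -
  have "(\<lambda>v::complex^'n. v $ i) \<in> borel_measurable borel"
    by (intro borel_measurable_continuous_onI continuous_intros)
  from measurable_compose[OF assms this] show ?thesis .
qed

text \<open>The type of vectors with one coordinate removed is not available, so Fubini's theorem for the
  \<open>j\<close>-th coordinate is obtained by adjoining an auxiliary variable of total mass one and exchanging
  it with the \<open>j\<close>-th coordinate, a permutation of the standard basis.\<close>

lemma nn_integral_coordinate:
  fixes f :: "complex ^ 'n \<Rightarrow> ennreal" and w :: "complex \<Rightarrow> ennreal"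
  assumes [measurable]: "f \<in> borel_measurable borel" "w \<in> borel_measurable borel"
    and w: "(\<integral>\<^sup>+\<zeta>. w \<zeta> \<partial>lborel) = 1"
  shows "(\<integral>\<^sup>+z. f z \<partial>lborel) = (\<integral>\<^sup>+z. w (z $ j) * (\<integral>\<^sup>+\<zeta>. f (upd z j \<zeta>) \<partial>lborel) \<partial>lborel)"
proof -
  define T :: "(complex^'n) \<times> complex \<Rightarrow> (complex^'n) \<times> complex"
    where "T = (\<lambda>q. (upd (fst q) j (snd q), fst q $ j))"
  have T [measurable]: "T \<in> borel_measurable borel"
    unfolding T_def by (intro borel_measurable_continuous_onI continuous_intros)
  have TT: "T (T q) = q" for q by (simp add: T_def prod_eq_iff vec_eq_iff)
  have Tb: "T b \<in> Basis" if b: "b \<in> Basis" for b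
  proof -
    consider v where "b = (v, 0)" "v \<in> Basis" | v where "b = (0, v)" "v \<in> Basis"
      using b unfolding Basis_prod_def by blast
    then show ?thesis
    proof cases
      case 1
      then obtain i u where v: "v = axis i u" "u \<in> Basis" by (auto simp: Basis_vec_def)
      show ?thesis
      proof (cases "i = j")
        case True
        then have "T b = (0, u)" by (auto simp: T_def 1 v vec_eq_iff axis_def)
        then show ?thesis using v by (auto simp: Basis_prod_def)
      next
        case False
        then have "T b = b" by (auto simp: T_def 1 v vec_eq_iff axis_def)
        then show ?thesis using b by simp
      qed
    next
      case 2
      then have "T b = (axis j v, 0)" by (auto simp: T_def vec_eq_iff axis_def)
      then show ?thesis using 2 by (auto simp: Basis_prod_def Basis_vec_def)
    qed
  qed
  have bij: "bij_betw T Basis Basis"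
    by (rule bij_betw_byWitness[where f' = T]) (auto simp: TT Tb)
  have inner: "T x \<bullet> T y = x \<bullet> y" for x y
  proof -
    have "upd (fst x) j (snd x) \<bullet> upd (fst y) j (snd y) + (fst x $ j) \<bullet> (fst y $ j)
      = (\<Sum>i\<in>UNIV - {j}. fst x $ i \<bullet> fst y $ i) + snd x \<bullet> snd y + (fst x $ j) \<bullet> (fst y $ j)"
      by (simp add: inner_vec_def sum.remove[of UNIV j])
    also have "\<dots> = fst x \<bullet> fst y + snd x \<bullet> snd y"
      by (simp add: inner_vec_def sum.remove[of UNIV j])
    finally show ?thesis by (simp add: T_def inner_prod_def)
  qed
  have distr: "distr lborel borel T = lborel"
    by (rule lborel_distr_basis_permutation[OF T bij]) (simp add: inner)
  define g :: "(complex^'n) \<times> complex \<Rightarrow> ennreal" where "g = (\<lambda>q. f (fst q) * w (snd q))"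
  have "g \<in> borel_measurable (borel \<Otimes>\<^sub>M borel)"
    unfolding g_def by measurable
  then have g: "g \<in> borel_measurable borel"
    by (simp only: borel_prod)
  have gT: "(\<lambda>q. g (T q)) \<in> borel_measurable borel"
    using T g by (rule measurable_compose)
  have "(\<integral>\<^sup>+z. f z \<partial>lborel) = (\<integral>\<^sup>+z. \<integral>\<^sup>+\<zeta>. g (z, \<zeta>) \<partial>lborel \<partial>lborel)"
    by (simp add: nn_integral_cmult w g_def)
  also have "\<dots> = (\<integral>\<^sup>+q. g q \<partial>(lborel \<Otimes>\<^sub>M lborel))"
    by (rule lborel.nn_integral_fst) (simp only: lborel_prod measurable_lborel2 g)
  also have "\<dots> = (\<integral>\<^sup>+q. g q \<partial>distr lborel borel T)"
    by (simp only: lborel_prod distr)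
  also have "\<dots> = (\<integral>\<^sup>+q. g (T q) \<partial>lborel)"
    by (rule nn_integral_distr) (use T g in simp_all)
  also have "\<dots> = (\<integral>\<^sup>+q. g (T q) \<partial>(lborel \<Otimes>\<^sub>M lborel))"
    by (simp only: lborel_prod)
  also have "\<dots> = (\<integral>\<^sup>+z. \<integral>\<^sup>+\<zeta>. g (T (z, \<zeta>)) \<partial>lborel \<partial>lborel)"
    by (rule lborel.nn_integral_fst[symmetric]) (simp only: lborel_prod measurable_lborel2 gT)
  also have "\<dots> = (\<integral>\<^sup>+z. \<integral>\<^sup>+\<zeta>. f (upd z j \<zeta>) * w (z $ j) \<partial>lborel \<partial>lborel)"
    by (simp add: g_def T_def)
  also have "\<dots> = (\<integral>\<^sup>+z. w (z $ j) * (\<integral>\<^sup>+\<zeta>. f (upd z j \<zeta>) \<partial>lborel) \<partial>lborel)"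
    by (intro nn_integral_cong, subst nn_integral_multc) (measurable, simp add: mult.commute)
  finally show ?thesis .
qed

text \<open>The normalised indicator of the ball. Total mass one is what Fubini in one coordinate
  asks of its auxiliary weight; being nonzero on the ball is used later to deduce finiteness of
  slice integrals from finiteness of the weighted ones.\<close>

lemma ex_prob_density_on_ball:
  fixes r :: real
  assumes "r > 0"
  obtains w :: "complex \<Rightarrow> ennreal" where "w \<in> borel_measurable borel"
    "(\<integral>\<^sup>+\<zeta>. w \<zeta> \<partial>lborel) = 1" "\<And>\<zeta>. cmod \<zeta> < r \<Longrightarrow> w \<zeta> \<noteq> 0"
proof -
  define e where "e = measure lborel (ball (0::complex) r)"
  have e: "emeasure lborel (ball (0::complex) r) = ennreal e"
    unfolding e_def by (rule emeasure_eq_ennreal_measure) (use emeasure_lborel_ball_finite[of "0::complex" r] in auto)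
  have "e \<noteq> 0"
  proof
    assume "e = 0"
    then have "ball (0::complex) r \<in> null_sets lborel" by (auto simp: e null_sets_def)
    then have "negligible (ball (0::complex) r)" by (metis negligible_iff_null_sets null_sets_completionI)
    then show False using assms open_not_negligible[of "ball (0::complex) r"] by auto
  qed
  then have e0: "e > 0" using measure_nonneg[of lborel "ball (0::complex) r"] by (simp add: e_def)
  show ?thesis
  proof
    show "(\<lambda>\<zeta>. ennreal (1 / e) * indicator (ball 0 r) \<zeta>) \<in> borel_measurable borel"
      by (intro borel_measurable_const borel_measurable_times_ennreal borel_measurable_indicator) simp
    show "(\<integral>\<^sup>+\<zeta>. ennreal (1 / e) * indicator (ball (0::complex) r) \<zeta> \<partial>lborel) = 1"
      using e0 by (subst nn_integral_cmult_indicator) (simp_all add: e ennreal_mult[symmetric])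
    show "ennreal (1 / e) * indicator (ball 0 r) \<zeta> \<noteq> 0" if "cmod \<zeta> < r" for \<zeta>
      using that e0 by simp
  qed
qed

lemma AE_coordinate_nonzero: "AE z in lborel. (z :: complex^'n) $ i \<noteq> 0"
proof -
  have "negligible {z :: complex^'n. axis i 1 \<bullet> z = 0}"
    by (rule negligible_hyperplane) (auto simp: axis_eq_0_iff)
  moreover have "{z :: complex^'n. z $ i = 0} \<subseteq> {z. axis i 1 \<bullet> z = 0}"
    by (auto simp: inner_axis' )
  ultimately have "negligible {z :: complex^'n. z $ i = 0}"
    by (rule negligible_subset)
  moreover have "{z :: complex^'n. z $ i = 0} \<in> sets lborel"
    by measurable
  ultimately have "{z :: complex^'n. z $ i = 0} \<in> null_sets lborel"
    by (metis negligible_iff_null_sets null_sets_completion_iff)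
  then show ?thesis by (rule AE_I') auto
qed

text \<open>With every coordinate but the j-th frozen, the shear is multiplication by the constant
  \<open>z $ i ^ k\<close>, which scales area by |z_i|^(2k). The slices with z_i = 0, where this
  constant may vanish, form a null set.\<close>

lemma nn_integral_shear:
  fixes f :: "complex ^ 'n \<Rightarrow> ennreal"
  assumes [measurable]: "f \<in> borel_measurable borel" and ij: "i \<noteq> j"
  shows "(\<integral>\<^sup>+z. f z \<partial>lborel)
       = (\<integral>\<^sup>+z. ennreal (cmod (z $ i) ^ (2 * k)) * f (upd z j (z $ i ^ k * z $ j)) \<partial>lborel)"
proof -
  obtain w :: "complex \<Rightarrow> ennreal" where w [measurable]: "w \<in> borel_measurable borel"
    and w1: "(\<integral>\<^sup>+\<zeta>. w \<zeta> \<partial>lborel) = 1"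
    using ex_prob_density_on_ball[of 1] by auto
  have "(\<integral>\<^sup>+z. f z \<partial>lborel) = (\<integral>\<^sup>+z. w (z $ j) * (\<integral>\<^sup>+\<zeta>. f (upd z j \<zeta>) \<partial>lborel) \<partial>lborel)"
    by (rule nn_integral_coordinate) (use w1 in auto)
  also have "\<dots> = (\<integral>\<^sup>+z. w (z $ j) * (\<integral>\<^sup>+\<zeta>. ennreal (cmod (upd z j \<zeta> $ i) ^ (2 * k)) *
       f (upd (upd z j \<zeta>) j (upd z j \<zeta> $ i ^ k * upd z j \<zeta> $ j)) \<partial>lborel) \<partial>lborel)"
  proof (intro nn_integral_cong_AE, use AE_coordinate_nonzero[of i] in eventually_elim)
    case (elim z)
    have "(\<integral>\<^sup>+\<zeta>. f (upd z j \<zeta>) \<partial>lborel)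
        = ennreal ((cmod (z $ i ^ k))\<^sup>2) * (\<integral>\<^sup>+\<zeta>. f (upd z j (z $ i ^ k * \<zeta>)) \<partial>lborel)"
      by (rule nn_integral_complex_mult[symmetric]) (use elim in auto)
    also have "\<dots> = (\<integral>\<^sup>+\<zeta>. ennreal (cmod (z $ i) ^ (2 * k)) * f (upd z j (z $ i ^ k * \<zeta>)) \<partial>lborel)"
      by (simp add: nn_integral_cmult norm_power power_mult[symmetric] mult.commute)
    finally show ?case using ij by simp
  qed
  also have "\<dots> = (\<integral>\<^sup>+z. ennreal (cmod (z $ i) ^ (2 * k)) * f (upd z j (z $ i ^ k * z $ j)) \<partial>lborel)"
    by (rule nn_integral_coordinate[symmetric]) (use w1 in auto)
  finally show ?thesis .
qed

section \<open>Holomorphic functions of several variables\<close>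

lemma has_derivative_smult_line:
  fixes a v :: "complex ^ 'n"
  shows "((\<lambda>\<zeta>. a + \<zeta> *s v) has_derivative (\<lambda>h. h *s v)) (at \<zeta>0)"
proof -
  have "bounded_linear (\<lambda>h. h *s v)"
    by (rule linear_conv_bounded_linear[THEN iffD1], rule linearI)
       (simp_all add: vec_eq_iff algebra_simps)
  then show ?thesis
    by (auto intro!: derivative_eq_intros bounded_linear_imp_has_derivative)
qed

lemma continuous_on_smult [continuous_intros]:
  fixes f :: "'a::topological_space \<Rightarrow> complex" and g :: "'a \<Rightarrow> complex ^ 'n"
  assumes "continuous_on S f" "continuous_on S g"
  shows "continuous_on S (\<lambda>x. f x *s g x)"
  unfolding vector_scalar_mult_def by (intro continuous_intros assms)

lemma holo_fun_onD:
  assumes "holo_fun_on f D" "z \<in> D"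
  obtains f' where "(f has_derivative f') (at z)" "\<And>c v. f' (c *s v) = c * f' v"
  using assms unfolding holo_fun_on_def by blast

lemma holo_fun_on_continuous:
  assumes "holo_fun_on f D"
  shows "continuous_on D f"
  using assms unfolding holo_fun_on_def
  by (meson continuous_at_imp_continuous_on has_derivative_continuous)

lemma holo_fun_on_subset: "holo_fun_on f D \<Longrightarrow> E \<subseteq> D \<Longrightarrow> holo_fun_on f E"
  unfolding holo_fun_on_def by blast

lemma holo_fun_on_cong:
  assumes "holo_fun_on f D" "open D" "\<And>z. z \<in> D \<Longrightarrow> g z = f z"
  shows "holo_fun_on g D"
  unfolding holo_fun_on_def
proof
  fix z assume z: "z \<in> D"
  obtain f' where f': "(f has_derivative f') (at z)" "\<And>c v. f' (c *s v) = c * f' v"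
    using holo_fun_onD[OF assms(1) z] by blast
  have "(g has_derivative f') (at z)"
    by (rule has_derivative_transform_within_open[OF f'(1) assms(2) z]) (simp add: assms(3))
  then show "\<exists>f'. (g has_derivative f') (at z) \<and> (\<forall>c v. f' (c *s v) = c * f' v)"
    using f'(2) by blast
qed

lemma holo_fun_on_nth: "holo_fun_on (\<lambda>z. z $ i) D"
  unfolding holo_fun_on_def
  by (intro ballI exI[of _ "\<lambda>z. z $ i"] conjI bounded_linear_imp_has_derivative bounded_linear_vec_nth) simp

lemma holo_fun_on_const: "holo_fun_on (\<lambda>z. c) D"
  unfolding holo_fun_on_def by (intro ballI exI[of _ "\<lambda>z. 0"]) simp

lemma holo_fun_on_compose_field:
  assumes f: "holo_fun_on f D" and h: "h holomorphic_on S" "open S" and fD: "\<And>z. z \<in> D \<Longrightarrow> f z \<in> S"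
  shows "holo_fun_on (\<lambda>z. h (f z)) D"
  unfolding holo_fun_on_def
proof
  fix z assume z: "z \<in> D"
  obtain f' where f': "(f has_derivative f') (at z)" "\<And>c v. f' (c *s v) = c * f' v"
    using holo_fun_onD[OF f z] by blast
  have "(h has_field_derivative deriv h (f z)) (at (f z))"
    using h fD[OF z] by (rule holomorphic_derivI)
  then have "(h has_derivative (*) (deriv h (f z))) (at (f z))"
    by (simp add: has_field_derivative_def)
  from has_derivative_compose[OF f'(1) this]
  show "\<exists>f'. ((\<lambda>z. h (f z)) has_derivative f') (at z) \<and> (\<forall>c v. f' (c *s v) = c * f' v)"
    by (intro exI conjI) (auto simp: f'(2))
qed

lemma holo_fun_on_add:
  assumes "holo_fun_on f D" "holo_fun_on g D"
  shows "holo_fun_on (\<lambda>z. f z + g z) D"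
  unfolding holo_fun_on_def
proof
  fix z assume z: "z \<in> D"
  obtain f' where f': "(f has_derivative f') (at z)" "\<And>c v. f' (c *s v) = c * f' v"
    using holo_fun_onD[OF assms(1) z] by blast
  obtain g' where g': "(g has_derivative g') (at z)" "\<And>c v. g' (c *s v) = c * g' v"
    using holo_fun_onD[OF assms(2) z] by blast
  from has_derivative_add[OF f'(1) g'(1)]
  show "\<exists>f'. ((\<lambda>z. f z + g z) has_derivative f') (at z) \<and> (\<forall>c v. f' (c *s v) = c * f' v)"
    by (intro exI conjI) (auto simp: f'(2) g'(2) algebra_simps)
qed

lemma holo_fun_on_mult:
  assumes "holo_fun_on f D" "holo_fun_on g D"
  shows "holo_fun_on (\<lambda>z. f z * g z) D"
  unfolding holo_fun_on_def
proof
  fix z assume z: "z \<in> D"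
  obtain f' where f': "(f has_derivative f') (at z)" "\<And>c v. f' (c *s v) = c * f' v"
    using holo_fun_onD[OF assms(1) z] by blast
  obtain g' where g': "(g has_derivative g') (at z)" "\<And>c v. g' (c *s v) = c * g' v"
    using holo_fun_onD[OF assms(2) z] by blast
  from has_derivative_mult[OF f'(1) g'(1)]
  show "\<exists>f'. ((\<lambda>z. f z * g z) has_derivative f') (at z) \<and> (\<forall>c v. f' (c *s v) = c * f' v)"
    by (intro exI conjI) (auto simp: f'(2) g'(2) algebra_simps)
qed

lemma holo_fun_on_power:
  assumes "holo_fun_on f D"
  shows "holo_fun_on (\<lambda>z. f z ^ k) D"
  by (rule holo_fun_on_compose_field[OF assms, of "\<lambda>x. x ^ k" UNIV]) (auto intro!: holomorphic_intros)

lemma holo_fun_on_divide: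
  assumes "holo_fun_on f D" "holo_fun_on g D" "\<And>z. z \<in> D \<Longrightarrow> g z \<noteq> 0"
  shows "holo_fun_on (\<lambda>z. f z / g z) D"
proof -
  have "holo_fun_on (\<lambda>z. inverse (g z)) D"
    by (rule holo_fun_on_compose_field[OF assms(2), of inverse "- {0}"])
       (use assms(3) in \<open>auto intro!: holomorphic_intros\<close>)
  from holo_fun_on_mult[OF assms(1) this] show ?thesis
    by (simp add: divide_inverse)
qed

lemma holo_fun_on_sum:
  assumes "finite I" "\<And>i. i \<in> I \<Longrightarrow> holo_fun_on (f i) D"
  shows "holo_fun_on (\<lambda>z. \<Sum>i\<in>I. f i z) D"
  using assms by (induction I) (auto intro: holo_fun_on_const holo_fun_on_add)

lemma holo_map_onD:
  fixes F :: "complex ^ 'n \<Rightarrow> complex ^ 'm"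
  assumes F: "holo_map_on F D" and z: "z \<in> D"
  obtains F' where "(F has_derivative F') (at z)" "\<And>c v. F' (c *s v) = c *s F' v"
proof -
  have "\<forall>i. \<exists>f'. ((\<lambda>z. F z $ i) has_derivative f') (at z) \<and> (\<forall>c v. f' (c *s v) = c * f' v)"
    using F z by (auto simp: holo_map_on_def holo_fun_on_def)
  then obtain f' where f': "\<And>i. ((\<lambda>z. F z $ i) has_derivative f' i) (at z)"
      "\<And>i c v. f' i (c *s v) = c * f' i v"
    by metis
  define F' where "F' v = (\<chi> i. f' i v)" for v
  have "(F has_derivative F') (at z)"
  proof (subst has_derivative_componentwise_within, intro ballI)
    fix e :: "complex ^ 'm" assume "e \<in> Basis"
    then obtain i b where e: "e = axis i b" by (auto simp: Basis_vec_def)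
    have "((\<lambda>x. F x $ i \<bullet> b) has_derivative (\<lambda>x. f' i x \<bullet> b)) (at z)"
      by (rule has_derivative_inner_left[OF f'(1)])
    then show "((\<lambda>x. F x \<bullet> e) has_derivative (\<lambda>x. F' x \<bullet> e)) (at z)"
      by (simp add: e inner_axis F'_def)
  qed
  moreover have "F' (c *s v) = c *s F' v" for c v
    by (simp add: vec_eq_iff F'_def f'(2))
  ultimately show ?thesis using that by blast
qed

lemma holo_map_on_continuous:
  assumes "holo_map_on F D"
  shows "continuous_on D F"
  by (rule continuous_at_imp_continuous_on)
     (use assms holo_map_onD in \<open>metis has_derivative_continuous\<close>)

lemma holo_fun_on_compose:
  assumes f: "holo_fun_on f E" and F: "holo_map_on F D" and FD: "\<And>z. z \<in> D \<Longrightarrow> F z \<in> E"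
  shows "holo_fun_on (\<lambda>z. f (F z)) D"
  unfolding holo_fun_on_def
proof
  fix z assume z: "z \<in> D"
  obtain F' where F': "(F has_derivative F') (at z)" "\<And>c v. F' (c *s v) = c *s F' v"
    using holo_map_onD[OF F z] by blast
  obtain f' where f': "(f has_derivative f') (at (F z))" "\<And>c v. f' (c *s v) = c * f' v"
    using holo_fun_onD[OF f FD[OF z]] by blast
  from has_derivative_compose[OF F'(1) f'(1)]
  show "\<exists>f'. ((\<lambda>z. f (F z)) has_derivative f') (at z) \<and> (\<forall>c v. f' (c *s v) = c * f' v)"
    by (intro exI conjI) (auto simp: f'(2) F'(2))
qed

lemma holo_map_on_compose:
  assumes "holo_map_on G E" "holo_map_on F D" "\<And>z. z \<in> D \<Longrightarrow> F z \<in> E"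
  shows "holo_map_on (\<lambda>z. G (F z)) D"
  using assms holo_fun_on_compose unfolding holo_map_on_def by blast

lemma holo_map_on_subset: "holo_map_on f D \<Longrightarrow> E \<subseteq> D \<Longrightarrow> holo_map_on f E"
  unfolding holo_map_on_def using holo_fun_on_subset by blast

lemma holo_map_on_upd:
  assumes "holo_fun_on f D"
  shows "holo_map_on (\<lambda>z. upd z j (f z)) D"
  unfolding holo_map_on_def
proof
  show "holo_fun_on (\<lambda>z. upd z j (f z) $ i) D" for i
    using assms by (cases "i = j") (auto intro: holo_fun_on_nth)
qed

section \<open>Restriction to complex lines\<close>

lemma has_field_derivative_on_line:
  fixes f :: "complex ^ 'n \<Rightarrow> complex"
  assumes "(f has_derivative f') (at (a + \<zeta> *s v))" "\<And>c v. f' (c *s v) = c * f' v"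
  shows "((\<lambda>\<zeta>. f (a + \<zeta> *s v)) has_field_derivative f' v) (at \<zeta>)"
proof -
  have "((\<lambda>\<zeta>. f (a + \<zeta> *s v)) has_derivative (\<lambda>h. f' (h *s v))) (at \<zeta>)"
    by (rule has_derivative_compose[OF has_derivative_smult_line assms(1)])
  moreover have "(\<lambda>h. f' (h *s v)) = (*) (f' v)"
    by (auto simp: assms(2))
  ultimately show ?thesis by (simp add: has_field_derivative_def)
qed

lemma holo_fun_on_line:
  assumes f: "holo_fun_on f D" and S: "open S" "\<And>\<zeta>. \<zeta> \<in> S \<Longrightarrow> a + \<zeta> *s v \<in> D"
  shows "(\<lambda>\<zeta>. f (a + \<zeta> *s v)) holomorphic_on S"
proof (subst holomorphic_on_open[OF S(1)], intro ballI)
  fix \<zeta> assume "\<zeta> \<in> S"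
  then obtain f' where "(f has_derivative f') (at (a + \<zeta> *s v))" "\<And>c v. f' (c *s v) = c * f' v"
    using holo_fun_onD[OF f S(2)] by blast
  then show "\<exists>f'. ((\<lambda>\<zeta>. f (a + \<zeta> *s v)) has_field_derivative f') (at \<zeta>)"
    using has_field_derivative_on_line by blast
qed

lemma upd_eq_line: "upd z i \<zeta> = upd z i 0 + \<zeta> *s axis i 1"
  by (simp add: vec_eq_iff axis_def)

lemma holo_fun_on_slice:
  assumes f: "holo_fun_on f D" and S: "open S" "\<And>\<zeta>. \<zeta> \<in> S \<Longrightarrow> upd z i \<zeta> \<in> D"
  shows "(\<lambda>\<zeta>. f (upd z i \<zeta>)) holomorphic_on S"
  using holo_fun_on_line[OF f S(1), of "upd z i 0" "axis i 1"] S(2)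
  by (simp flip: upd_eq_line)

section \<open>Cauchy integrals over circles and holomorphic dependence on a parameter\<close>

lemma circlepath_cis: "circlepath 0 r t = r * cis (2 * pi * t)"
  by (simp add: circlepath cis_conv_exp mult_ac)

lemma vector_derivative_circlepath_cis:
  "t \<in> {0..1} \<Longrightarrow> vector_derivative (circlepath 0 r) (at t within {0..1})
     = 2 * of_real pi * \<i> * (r * cis (2 * pi * t))"
  by (simp add: vector_derivative_circlepath01 cis_conv_exp mult_ac)

text \<open>With u = r e^(2 pi i t) the differential du is 2 pi i u dt, which cancels the factor 2
  pi i and leaves the kernel u/(u - w). As an integral over the real interval [0, 1] it is open to
  differentiation under the integral sign.\<close>

lemma Cauchy_integral_circle:
  assumes f: "f holomorphic_on ball 0 R" and r: "0 < r" "r < R" and w: "cmod w < r"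
  shows "((\<lambda>t. f (r * cis (2 * pi * t)) * (r * cis (2 * pi * t)) / (r * cis (2 * pi * t) - w))
    has_integral f w) {0..1}"
proof -
  have "f holomorphic_on cball 0 r"
    by (rule holomorphic_on_subset[OF f]) (use r in auto)
  then have "((\<lambda>u. f u / (u - w)) has_contour_integral (2 * of_real pi * \<i> * f w)) (circlepath 0 r)"
    by (rule Cauchy_integral_circlepath_simple) (use w in auto)
  then have "((\<lambda>t. f (circlepath 0 r t) / (circlepath 0 r t - w)
      * vector_derivative (circlepath 0 r) (at t within {0..1})) has_integral 2 * of_real pi * \<i> * f w) {0..1}"
    by (simp add: has_contour_integral_def)
  then have "((\<lambda>t. f (r * cis (2 * pi * t)) / (r * cis (2 * pi * t) - w)
      * (2 * of_real pi * \<i> * (r * cis (2 * pi * t)))) has_integral 2 * of_real pi * \<i> * f w) {0..1}"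
    by (rule has_integral_eq[rotated])
       (simp only: circlepath_cis vector_derivative_circlepath_cis of_real_1 mult_1_left)
  from has_integral_mult_right[OF this, of "1 / (2 * of_real pi * \<i>)"] show ?thesis
    by (simp add: field_simps)
qed

text \<open>On the unit circle f(u)/u^2 times u equals f(u) times the conjugate of u, so the
  integrand contains no quotient and is visibly continuous in any parameters of f.\<close>

lemma Cauchy_integral_circle_deriv:
  assumes f: "f holomorphic_on ball 0 R" and R: "1 < R"
  shows "((\<lambda>t. f (cis (2 * pi * t)) * cnj (cis (2 * pi * t))) has_integral deriv f 0) {0..1}"
proof -
  have f1: "f holomorphic_on cball 0 1"
    by (rule holomorphic_on_subset[OF f]) (use R in auto)
  have "((\<lambda>u. f u / (u - 0) ^ Suc 1) has_contour_integral ((2 * pi * \<i>) / (fact 1) * (deriv ^^ 1) f 0)) (circlepath 0 1)"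
    by (rule Cauchy_has_contour_integral_higher_derivative_circlepath)
       (use holomorphic_on_imp_continuous_on[OF f1] holomorphic_on_subset[OF f1 ball_subset_cball] in auto)
  then have "((\<lambda>t. f (circlepath 0 1 t) / (circlepath 0 1 t)\<^sup>2
      * vector_derivative (circlepath 0 1) (at t within {0..1})) has_integral 2 * of_real pi * \<i> * deriv f 0) {0..1}"
    by (simp add: has_contour_integral_def power2_eq_square)
  then have "((\<lambda>t. f (cis (2 * pi * t)) / (cis (2 * pi * t))\<^sup>2
      * (2 * of_real pi * \<i> * cis (2 * pi * t))) has_integral 2 * of_real pi * \<i> * deriv f 0) {0..1}"
    by (rule has_integral_eq[rotated])
       (simp only: circlepath_cis vector_derivative_circlepath_cis of_real_1 mult_1_left)
  from has_integral_mult_right[OF this, of "1 / (2 * of_real pi * \<i>)"] show ?thesis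
    by (simp add: field_simps power2_eq_square cis_cnj cis_inverse flip: cis_inverse)
qed

text \<open>The Leibniz rule wants the derivative in z to be jointly continuous in (z, t), which
  pointwise differentiability does not provide. Cauchy's formula supplies it: each directional
  derivative is an integral of \<phi> itself over a small circle, and \<phi> is jointly
  continuous.\<close>

lemma holo_fun_on_integral:
  fixes \<phi> :: "complex ^ 'n \<Rightarrow> real \<Rightarrow> complex"
  assumes U: "open U" and holo: "\<And>t. t \<in> {a..b} \<Longrightarrow> holo_fun_on (\<lambda>z. \<phi> z t) U"
    and cont: "continuous_on (U \<times> {a..b}) (\<lambda>(z, t). \<phi> z t)"
  shows "holo_fun_on (\<lambda>z. integral {a..b} (\<phi> z)) U"
  unfolding holo_fun_on_def
proof
  fix z0 assume "z0 \<in> U"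
  then obtain e where "e > 0" and e: "ball z0 e \<subseteq> U"
    using U open_contains_ball by blast
  \<comment> \<open>For z in the ball of radius \<epsilon> and |c| < 2, the point z + cu with |u| =
    \<epsilon> stays within 3 \<epsilon> of z0. This leaves a disc of radius 2 around the unit
    circle used by Cauchy's formula.\<close>
  define \<epsilon> where "\<epsilon> = e / 3"
  have \<epsilon>: "\<epsilon> > 0" "ball z0 (3 * \<epsilon>) \<subseteq> U" using \<open>e > 0\<close> e by (auto simp: \<epsilon>_def)
  define B where "B = ball z0 \<epsilon>"
  have BU: "B \<subseteq> U" using \<epsilon> by (auto simp: B_def)
  have "\<forall>z\<in>U. \<forall>t\<in>{a..b}. \<exists>f'. ((\<lambda>z. \<phi> z t) has_derivative f') (at z) \<and> (\<forall>c v. f' (c *s v) = c * f' v)"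
    using holo unfolding holo_fun_on_def by blast
  then obtain \<phi>' where \<phi>': "\<And>z t. z \<in> U \<Longrightarrow> t \<in> {a..b} \<Longrightarrow> ((\<lambda>z. \<phi> z t) has_derivative \<phi>' z t) (at z)"
     "\<And>z t c v. z \<in> U \<Longrightarrow> t \<in> {a..b} \<Longrightarrow> \<phi>' z t (c *s v) = c * \<phi>' z t v"
    by metis
  define fx where "fx z t = Blinfun (\<phi>' z t)" for z t
  have fx: "blinfun_apply (fx z t) = \<phi>' z t" if "z \<in> U" "t \<in> {a..b}" for z t
    unfolding fx_def using \<phi>'(1)[OF that] by (intro bounded_linear_Blinfun_apply has_derivative_bounded_linear)
  have contfx: "continuous_on (B \<times> {a..b}) (\<lambda>(z, t). fx z t)"
  proof (rule continuous_on_blinfun_componentwise)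
    fix v :: "complex ^ 'n" assume v: "v \<in> Basis"
    \<comment> \<open>The real basis vector v, which may be an axis vector or \<i> times one, is
      shortened to length \<epsilon>; by complex linearity the derivative along u is \<epsilon>
      times the one along v, hence the division by \<epsilon> below.\<close>
    define u where "u = complex_of_real \<epsilon> *s v"
    have nu: "norm u = \<epsilon>"
    proof -
      have "u = \<epsilon> *\<^sub>R v" unfolding u_def vec_eq_iff
        by (simp only: vector_smult_component vector_scaleR_component) (simp add: scaleR_conv_of_real)
      then show ?thesis using v \<epsilon> by simp
    qed
    have nsu: "norm (c *s u) = cmod c * \<epsilon>" for c
    proof -
      have "norm (c *s u) = cmod c * norm u"
        by (simp add: norm_vec_def norm_mult L2_set_right_distrib)
      then show ?thesis by (simp add: nu)
    qed
    have inU: "z + c *s u \<in> U" if "z \<in> B" "cmod c < 2" for z c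
    proof -
      have "dist z0 (z + c *s u) \<le> dist z0 z + norm (c *s u)"
        by (metis add_diff_cancel_left' dist_commute dist_norm dist_triangle)
      also have "\<dots> < \<epsilon> + 2 * \<epsilon>"
        using that \<epsilon> by (intro add_strict_mono) (auto simp: B_def nsu)
      finally show ?thesis using \<epsilon>(2) by auto
    qed
    have eq: "\<phi>' z t v = integral {0..1} (\<lambda>s. \<phi> (z + cis (2 * pi * s) *s u) t * cnj (cis (2 * pi * s))) / \<epsilon>"
      if zt: "z \<in> B" "t \<in> {a..b}" for z t
    proof -
      have hol: "(\<lambda>c. \<phi> (z + c *s u) t) holomorphic_on ball 0 2"
        by (rule holo_fun_on_line[OF holo[OF zt(2)]]) (use inU zt in auto)
      have "((\<lambda>c. \<phi> (z + c *s u) t) has_field_derivative \<phi>' z t u) (at 0)"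
        by (rule has_field_derivative_on_line) (use \<phi>' BU zt in auto)
      then have "deriv (\<lambda>c. \<phi> (z + c *s u) t) 0 = \<phi>' z t u"
        by (rule DERIV_imp_deriv)
      moreover have "\<phi>' z t u = \<epsilon> * \<phi>' z t v"
        unfolding u_def using \<phi>'(2) BU zt by blast
      ultimately show ?thesis
        using integral_unique[OF Cauchy_integral_circle_deriv[OF hol]] \<epsilon> by simp
    qed
    have "continuous_on ((B \<times> {a..b}) \<times> cbox 0 1)
       (\<lambda>(x, s). \<phi> (fst x + cis (2 * pi * s) *s u) (snd x) * cnj (cis (2 * pi * s)))"
    proof -
      have "continuous_on ((B \<times> {a..b}) \<times> cbox 0 1) (\<lambda>y. (fst (fst y) + cis (2 * pi * snd y) *s u, snd (fst y)))"
        unfolding cis_conv_exp by (intro continuous_intros)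
      moreover have "(\<lambda>y. (fst (fst y) + cis (2 * pi * snd y) *s u, snd (fst y))) ` ((B \<times> {a..b}) \<times> cbox 0 1) \<subseteq> U \<times> {a..b}"
        using inU by auto
      ultimately have "continuous_on ((B \<times> {a..b}) \<times> cbox 0 1)
           (\<lambda>y. case (fst (fst y) + cis (2 * pi * snd y) *s u, snd (fst y)) of (z, t) \<Rightarrow> \<phi> z t)"
        by (rule continuous_on_compose2[OF cont])
      then show ?thesis
        unfolding case_prod_beta cis_conv_exp fst_conv snd_conv by (intro continuous_intros)
    qed
    then have "continuous_on (B \<times> {a..b}) (\<lambda>x. integral (cbox 0 1)
       (\<lambda>s. \<phi> (fst x + cis (2 * pi * s) *s u) (snd x) * cnj (cis (2 * pi * s))) / \<epsilon>)"
      by (intro continuous_on_divide integral_continuous_on_param continuous_on_const) (use \<epsilon> in auto)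
    then show "continuous_on (B \<times> {a..b}) (\<lambda>x. blinfun_apply (case x of (z, t) \<Rightarrow> fx z t) v)"
      by (rule continuous_on_eq) (use fx BU eq in \<open>auto simp: cbox_interval\<close>)
  qed
  have z0B: "z0 \<in> B" using \<epsilon> by (simp add: B_def)
  have pair: "continuous_on {a..b} (\<lambda>t. (z, t))" for z :: "complex ^ 'n"
    by (intro continuous_on_Pair continuous_on_const continuous_on_id)
  have cphi: "continuous_on {a..b} (\<phi> z)" if "z \<in> B" for z
    using continuous_on_compose2[OF cont pair, of z] that BU by auto
  have "((\<lambda>z. integral (cbox a b) (\<phi> z)) has_derivative integral (cbox a b) (fx z0)) (at z0 within B)"
  proof (rule leibniz_rule)
    show "((\<lambda>z. \<phi> z t) has_derivative blinfun_apply (fx z t)) (at z within B)" if zt: "z \<in> B" "t \<in> cbox a b" for z t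
    proof -
      have zt': "z \<in> U" "t \<in> {a..b}" using zt BU by auto
      show ?thesis
        unfolding fx[OF zt'] by (rule has_derivative_at_withinI[OF \<phi>'(1)[OF zt']])
    qed
    show "continuous_on (B \<times> cbox a b) (\<lambda>(z, t). fx z t)"
      using contfx by (simp add: cbox_interval)
    show "\<phi> z integrable_on cbox a b" if "z \<in> B" for z
      using cphi[OF that] by (simp add: integrable_continuous_real cbox_interval)
  qed (use z0B in \<open>simp_all add: B_def\<close>)
  then have "((\<lambda>z. integral {a..b} (\<phi> z)) has_derivative integral {a..b} (fx z0)) (at z0)"
    using at_within_open[OF z0B] by (simp add: B_def)
  moreover have "continuous_on {a..b} (fx z0)"
    using continuous_on_compose2[OF contfx pair, of z0] z0B by auto
  then have int: "fx z0 integrable_on {a..b}"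
    by (rule integrable_continuous_real)
  have "integral {a..b} (fx z0) (c *s v) = c * integral {a..b} (fx z0) v" for c v
  proof -
    have "integral {a..b} (fx z0) (c *s v) = integral {a..b} (\<lambda>t. c * fx z0 t v)"
      unfolding blinfun_apply_integral[OF int]
      by (rule integral_cong) (use fx BU z0B \<phi>'(2) in auto)
    then show ?thesis
      by (simp add: blinfun_apply_integral[OF int])
  qed
  ultimately show "\<exists>f'. ((\<lambda>z. integral {a..b} (\<phi> z)) has_derivative f') (at z0) \<and> (\<forall>c v. f' (c *s v) = c * f' v)"
    by blast
qed

section \<open>Removable singularities of integrable holomorphic functions\<close>

lemma nn_integral_rotation:
  fixes h :: "complex \<Rightarrow> ennreal"
  assumes "h \<in> borel_measurable borel" "cmod c = 1"
  shows "(\<integral>\<^sup>+z. h (c * z) \<partial>lborel) = (\<integral>\<^sup>+z. h z \<partial>lborel)"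
proof -
  have "c \<noteq> 0" using assms(2) by auto
  from nn_integral_complex_mult[OF assms(1) this] assms(2) show ?thesis by simp
qed

text \<open>Polar coordinates are replaced by averaging: the area integral is unchanged by every
  rotation, so it equals its mean over all rotations. After Fubini the inner integral at z is the
  mean of |f| over the circle through z, which dominates |f(0)| by Cauchy's formula for w to f(wz)
  on the unit circle.\<close>

lemma area_mean_value:
  fixes f :: "complex \<Rightarrow> complex"
  assumes f: "f holomorphic_on ball 0 R" and s: "0 < s" "s < R"
  shows "ennreal (cmod (f 0)) * emeasure lborel (ball (0::complex) s)
       \<le> (\<integral>\<^sup>+z. indicator (ball 0 s) z * ennreal (cmod (f z)) \<partial>lborel)"
proof -
  define h :: "complex \<Rightarrow> ennreal" where "h z = indicator (ball 0 s) z * ennreal (cmod (f z))" for z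
  define F where "F z = (if z \<in> ball 0 s then f z else 0)" for z
  have cf: "continuous_on (ball 0 R) f"
    using f by (rule holomorphic_on_imp_continuous_on)
  have "F \<in> borel_measurable borel"
    unfolding F_def
    by (rule borel_measurable_continuous_on_if) (use s in \<open>auto intro: continuous_on_subset[OF cf]\<close>)
  moreover have h_eq: "h z = ennreal (cmod (F z))" for z by (simp add: h_def F_def)
  ultimately have h [measurable]: "h \<in> borel_measurable borel"
    unfolding h_eq[abs_def] by measurable
  have "(\<integral>\<^sup>+z. h z \<partial>lborel) = (\<integral>\<^sup>+t. indicator {0..1::real} t * (\<integral>\<^sup>+z. h z \<partial>lborel) \<partial>lborel)"
    by (simp add: nn_integral_multc)
  also have "\<dots> = (\<integral>\<^sup>+t. (\<integral>\<^sup>+z. indicator {0..1::real} t * h (cis (2 * pi * t) * z) \<partial>lborel) \<partial>lborel)"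
    using nn_integral_rotation[OF h] by (subst nn_integral_cmult) (auto simp: cis_conv_exp)
  also have "\<dots> = (\<integral>\<^sup>+z. (\<integral>\<^sup>+t. indicator {0..1::real} t * h (cis (2 * pi * t) * z) \<partial>lborel) \<partial>lborel)"
    by (rule lborel_pair.Fubini') (simp add: case_prod_beta cis_conv_exp)
  finally have eq: "(\<integral>\<^sup>+z. h z \<partial>lborel)
      = (\<integral>\<^sup>+z. (\<integral>\<^sup>+t. indicator {0..1::real} t * h (cis (2 * pi * t) * z) \<partial>lborel) \<partial>lborel)" .
  have "(\<integral>\<^sup>+z. ennreal (cmod (f 0)) * indicator (ball (0::complex) s) z \<partial>lborel) \<le> (\<integral>\<^sup>+z. h z \<partial>lborel)"
    unfolding eq
  proof (rule nn_integral_mono)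
    fix z :: complex
    show "ennreal (cmod (f 0)) * indicator (ball 0 s) z \<le> (\<integral>\<^sup>+t. indicator {0..1::real} t * h (cis (2 * pi * t) * z) \<partial>lborel)"
    proof (cases "z \<in> ball 0 s")
      case True
      have inR: "cmod (cis t * z) < s" for t
        using True by (simp add: norm_mult)
      have cont: "continuous_on {0..1} (\<lambda>t. f (cis (2 * pi * t) * z))"
      proof (rule continuous_on_compose2[OF cf])
        show "continuous_on {0..1} (\<lambda>t. cis (2 * pi * t) * z)"
          unfolding cis_conv_exp by (intro continuous_intros)
        show "(\<lambda>t. cis (2 * pi * t) * z) ` {0..1} \<subseteq> ball 0 R"
          using less_trans[OF inR s(2)] by auto
      qed
      have 1: "((\<lambda>t. f (cis (2 * pi * t) * z)) has_integral f 0) {0..1}"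
      proof (cases "z = 0")
        case True
        then show ?thesis using has_integral_const_real[of "f 0" 0 1] by simp
      next
        case False
        then have z0: "0 < cmod z" "cmod z < R" using \<open>z \<in> ball 0 s\<close> s by auto
        have "(\<lambda>w. f (w * z)) holomorphic_on ball 0 (R / cmod z)"
          using z0 by (intro holomorphic_on_compose_gen[OF _ f, unfolded o_def] holomorphic_intros)
             (auto simp: norm_mult field_simps)
        from Cauchy_integral_circle[OF this, of 1 0] z0 show ?thesis by simp
      qed
      have "cmod (f 0) \<le> integral {0..1} (\<lambda>t. cmod (f (cis (2 * pi * t) * z)))"
        unfolding integral_unique[OF 1, symmetric]
        by (rule integral_norm_bound_integral)
           (use cont 1 in \<open>auto intro!: integrable_continuous_real continuous_intros\<close>)
      then have "ennreal (cmod (f 0)) \<le> ennreal (integral {0..1} (\<lambda>t. cmod (f (cis (2 * pi * t) * z))))"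
        by (rule ennreal_leI)
      also have "\<dots> = (\<integral>\<^sup>+t. ennreal (indicator {0..1} t * cmod (f (cis (2 * pi * t) * z))) \<partial>lborel)"
        by (rule nn_integral_has_integral_lebesgue[symmetric])
           (use cont in \<open>auto intro!: integrable_continuous_real continuous_intros integrable_integral\<close>)
      also have "\<dots> = (\<integral>\<^sup>+t. indicator {0..1::real} t * h (cis (2 * pi * t) * z) \<partial>lborel)"
        using inR by (intro nn_integral_cong) (auto simp: h_def indicator_def)
      finally show ?thesis using True by simp
    qed simp
  qed
  then show ?thesis
    by (simp add: nn_integral_cmult_indicator h_def)
qed

text \<open>Truncation at height t in place of Hoelder's inequality: above t the negative exponent 1
  - p gives x = x^(1-p) x^p \<le> t^(1-p) x^p.\<close>

lemma le_add_powr_mult_powr: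
  fixes x t p :: real
  assumes "t > 0" "p > 1" "x \<ge> 0"
  shows "x \<le> t + t powr (1 - p) * x powr p"
proof (cases "x \<le> t")
  case False
  then have "x = x powr (1 - p) * x powr p"
    using assms by (simp flip: powr_add)
  also have "\<dots> \<le> t powr (1 - p) * x powr p"
    using False assms by (intro mult_right_mono powr_mono2') auto
  finally show ?thesis using assms by linarith
qed (use assms in \<open>simp add: add_increasing2\<close>)

lemma nn_integral_lborel_translate:
  fixes f :: "'a::euclidean_space \<Rightarrow> ennreal"
  assumes "f \<in> borel_measurable borel"
  shows "(\<integral>\<^sup>+x. f (c + x) \<partial>lborel) = (\<integral>\<^sup>+x. f x \<partial>lborel)"
proof -
  have "(\<integral>\<^sup>+x. f x \<partial>lborel) = (\<integral>\<^sup>+x. f x \<partial>distr lborel borel ((+) c))"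
    by (simp add: lborel_distr_plus)
  also have "\<dots> = (\<integral>\<^sup>+x. f (c + x) \<partial>lborel)"
    using assms by (subst nn_integral_distr) auto
  finally show ?thesis ..
qed

text \<open>The area mean value over the disc of radius |z|/2 around z bounds |f(z)| by an average
  of |f|, and truncation bounds that by the L^p mass. After multiplication by |z| the mass term
  carries |z|^(p-2), which tends to 0 since p > 2.\<close>

lemma Lp_punctured_disc_growth:
  fixes f :: "complex \<Rightarrow> complex"
  assumes f: "f holomorphic_on ball 0 R - {0}" and R: "R > 0" and p: "p > 2"
    and fin: "(\<integral>\<^sup>+z. indicator (ball 0 R - {0}) z * ennreal (cmod (f z) powr p) \<partial>lborel) < \<infinity>"
  shows "((\<lambda>z. z * f z) \<longlongrightarrow> 0) (at 0)"
proof -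
  define h :: "complex \<Rightarrow> ennreal" where "h z = indicator (ball 0 R - {0}) z * ennreal (cmod (f z) powr p)" for z
  have cf: "continuous_on (ball 0 R - {0}) f"
    using f by (rule holomorphic_on_imp_continuous_on)
  have h [measurable]: "h \<in> borel_measurable borel"
  proof -
    have F: "(\<lambda>z. if z \<in> ball 0 R - {0} then f z else 0) \<in> borel_measurable borel"
      by (rule borel_measurable_continuous_on_if) (use cf in auto)
    have "h = (\<lambda>z. ennreal (cmod (if z \<in> ball 0 R - {0} then f z else 0) powr p))"
      by (auto simp: h_def)
    with F show ?thesis by simp
  qed
  obtain n where n: "(\<integral>\<^sup>+z. h z \<partial>lborel) = ennreal n" "n \<ge> 0"
    using fin by (auto simp: h_def less_top_ennreal)
  have main: "cmod (z * f z) \<le> 2 * \<epsilon> + 2 * \<epsilon> powr (1 - p) * n / pi * (cmod z / 2) powr (p - 2)"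
    if z: "z \<noteq> 0" "cmod z < R / 2" and \<epsilon>: "\<epsilon> > 0" for z \<epsilon>
  proof -
    \<comment> \<open>The disc of radius s around z misses 0. The level t = \<epsilon>/s is tuned so
      that the truncated part, multiplied by |z| = 2s, contributes exactly 2 \<epsilon>, while
      t^(1-p)/s becomes \<epsilon>^(1-p) s^(p-2).\<close>
    define s where "s = cmod z / 2"
    define t where "t = \<epsilon> / s"
    have s: "s > 0" and t: "t > 0" using z \<epsilon> by (auto simp: s_def t_def)
    have inD: "z + w \<in> ball 0 R - {0}" if "cmod w < cmod z" for w
    proof -
      have "cmod (z + w) \<le> cmod z + cmod w" by (rule norm_triangle_ineq)
      moreover have "z + w \<noteq> 0" using that by (metis add_eq_0_iff norm_minus_cancel less_irrefl)
      ultimately show ?thesis using that z by auto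
    qed
    have hol: "(\<lambda>w. f (z + w)) holomorphic_on ball 0 (cmod z)"
    proof (rule holomorphic_on_compose_gen[OF _ f, unfolded o_def])
      show "(+) z ` ball 0 (cmod z) \<subseteq> ball 0 R - {0}"
        by (intro image_subsetI inD) simp
    qed (intro holomorphic_intros)
    have vol: "emeasure lborel (ball (0::complex) s) = ennreal (pi * s\<^sup>2)"
      using s by (simp add: emeasure_ball unit_ball_vol_2)
    have "ennreal (cmod (f z) * (pi * s\<^sup>2)) = ennreal (cmod (f (z + 0))) * emeasure lborel (ball (0::complex) s)"
      by (simp add: vol ennreal_mult')
    also have "\<dots> \<le> (\<integral>\<^sup>+w. indicator (ball 0 s) w * ennreal (cmod (f (z + w))) \<partial>lborel)"
      by (rule area_mean_value[OF hol]) (use s z in \<open>auto simp: s_def\<close>)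
    also have "\<dots> \<le> (\<integral>\<^sup>+w. ennreal t * indicator (ball 0 s) w + ennreal (t powr (1 - p)) * h (z + w) \<partial>lborel)"
    proof (rule nn_integral_mono)
      fix w
      show "indicator (ball 0 s) w * ennreal (cmod (f (z + w))) \<le> ennreal t * indicator (ball 0 s) w + ennreal (t powr (1 - p)) * h (z + w)"
      proof (cases "cmod w < s")
        case True
        then have "z + w \<in> ball 0 R - {0}"
          using s norm_ge_zero[of w] unfolding s_def by (intro inD) linarith
        then have "h (z + w) = ennreal (cmod (f (z + w)) powr p)"
          unfolding h_def by (subst indicator_simps(1)) auto
        moreover have "ennreal (cmod (f (z + w))) \<le> ennreal (t + t powr (1 - p) * cmod (f (z + w)) powr p)"
          by (intro ennreal_leI le_add_powr_mult_powr) (use t p in auto)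
        ultimately show ?thesis
          using True t by (simp add: ennreal_mult)
      qed simp
    qed
    also have "\<dots> = ennreal t * emeasure lborel (ball (0::complex) s) + ennreal (t powr (1 - p)) * (\<integral>\<^sup>+w. h (z + w) \<partial>lborel)"
    proof -
      have "(\<lambda>w::complex. ennreal t * indicator (ball 0 s) w) \<in> borel_measurable borel"
        by (intro borel_measurable_times_ennreal borel_measurable_const borel_measurable_indicator) simp
      then show ?thesis
        by (subst nn_integral_add) (simp_all add: nn_integral_cmult nn_integral_cmult_indicator)
    qed
    also have "\<dots> = ennreal (t * (pi * s\<^sup>2) + t powr (1 - p) * n)"
      using t n(2) by (simp add: nn_integral_lborel_translate n vol ennreal_mult)
    finally have "cmod (f z) * (pi * s\<^sup>2) \<le> t * (pi * s\<^sup>2) + t powr (1 - p) * n"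
      by (rule ennreal_le_iff[THEN iffD1, rotated]) (use t n in auto)
    then have "cmod (f z) * (pi * s\<^sup>2) * (2 / (pi * s)) \<le> (t * (pi * s\<^sup>2) + t powr (1 - p) * n) * (2 / (pi * s))"
      using s by (intro mult_right_mono) auto
    also have "cmod (f z) * (pi * s\<^sup>2) * (2 / (pi * s)) = cmod (z * f z)"
      using s by (simp add: norm_mult s_def power2_eq_square field_simps)
    also have "(t * (pi * s\<^sup>2) + t powr (1 - p) * n) * (2 / (pi * s)) = 2 * (t * s) + 2 * (t powr (1 - p) / s) * n / pi"
      using s by (simp add: power2_eq_square field_simps)
    also have "t * s = \<epsilon>" using s by (simp add: t_def)
    also have "t powr (1 - p) / s = \<epsilon> powr (1 - p) * s powr (p - 2)"
    proof -
      have "t powr (1 - p) = \<epsilon> powr (1 - p) * s powr (p - 1)"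
        using s \<epsilon> powr_minus_divide[of s "p - 1"] by (simp add: t_def powr_divide powr_minus_divide field_simps)
      moreover have "s powr (p - 1) / s = s powr (p - 2)"
        using s powr_diff[of s "p - 1" 1] by simp
      ultimately show ?thesis by (metis times_divide_eq_right)
    qed
    finally show ?thesis by (simp add: s_def mult_ac)
  qed
  show ?thesis
  proof (rule tendstoI)
    fix e :: real assume e: "e > 0"
    \<comment> \<open>The parameter e/4 makes the first term of \<open>main\<close> equal to e/2; C
      is the resulting coefficient of the second term.\<close>
    define C where "C = 2 * (e / 4) powr (1 - p) * n / pi"
    have "((\<lambda>z. C * (cmod z / 2) powr (p - 2)) \<longlongrightarrow> C * 0) (at 0)"
      by (intro tendsto_mult tendsto_const tendsto_zero_powrI[of _ _ _ "p - 2"])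
         (use p in \<open>auto intro!: tendsto_eq_intros\<close>)
    then have "\<forall>\<^sub>F z in at 0. C * (cmod z / 2) powr (p - 2) < e / 2"
      using e by (intro order_tendstoD(2)[of _ "C * 0"]) auto
    moreover have "\<forall>\<^sub>F z in at (0::complex). z \<noteq> 0 \<and> cmod z < R / 2"
      using R by (auto simp: eventually_at intro!: exI[of _ "R / 2"])
    ultimately show "\<forall>\<^sub>F z in at 0. dist (z * f z) 0 < e"
    proof eventually_elim
      case (elim z)
      have "cmod (z * f z) \<le> 2 * (e / 4) + 2 * (e / 4) powr (1 - p) * n / pi * (cmod z / 2) powr (p - 2)"
        by (rule main) (use elim e in auto)
      then show ?case using elim e by (simp add: C_def)
    qed
  qed
qed

section \<open>Extension across a coordinate hyperplane\<close>

lemma norm_axis_complex: "norm (axis i c :: complex ^ 'n) = cmod c"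
proof -
  have "(\<Sum>l\<in>UNIV. (cmod (axis i c $ l))\<^sup>2) = (\<Sum>l\<in>UNIV. if l = i then (cmod c)\<^sup>2 else 0)"
    by (intro sum.cong) (auto simp: axis_def)
  then show ?thesis by (simp add: norm_vec_def L2_set_def)
qed

lemma holo_fun_on_diff:
  assumes "holo_fun_on f D" "holo_fun_on g D"
  shows "holo_fun_on (\<lambda>z. f z - g z) D"
  using holo_fun_on_add[OF assms(1) holo_fun_on_mult[OF holo_fun_on_const[of "-1"] assms(2)]]
  by simp

text \<open>The set where the functions differ is open and null, and a nonempty open set has
  positive measure.\<close>

lemma continuous_AE_eq_imp_eq:
  fixes f g :: "'a::euclidean_space \<Rightarrow> 'b::real_normed_vector"
  assumes V: "open V" and f: "continuous_on V f" and g: "continuous_on V g"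
    and AE: "AE z in lborel. z \<in> V \<longrightarrow> f z = g z" and z: "z \<in> V"
  shows "f z = g z"
proof (rule ccontr)
  assume ne: "f z \<noteq> g z"
  define S where "S = V \<inter> (\<lambda>z. f z - g z) -` (- {0})"
  have S: "open S"
    unfolding S_def by (rule continuous_open_preimage) (use V f g in \<open>auto intro!: continuous_intros\<close>)
  have "S \<in> null_sets lborel"
  proof (rule AE_iff_null_sets[THEN iffD2])
    show "AE z in lborel. z \<notin> S" using AE by eventually_elim (auto simp: S_def)
  qed (use S in auto)
  then have "negligible S"
    by (metis negligible_iff_null_sets null_sets_completionI)
  then have "S = {}" using S open_not_negligible by blast
  then show False using z ne by (auto simp: S_def)
qed

lemma open_coordinate_nonzero: "open {z :: complex ^ 'n. z $ i \<noteq> 0}"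
  by (rule open_Collect_neq) (auto intro!: continuous_intros)

lemma measurable_norm_powr_on:
  fixes g :: "'a::euclidean_space \<Rightarrow> 'b::real_normed_vector"
  assumes V: "open V" and g: "continuous_on V g"
  shows "(\<lambda>z. indicator V z * ennreal (norm (g z) powr p)) \<in> borel_measurable borel"
proof -
  have "(\<lambda>z. indicator V z * ennreal (norm (g z) powr p))
      = (\<lambda>z. indicator V z * ennreal (norm (if z \<in> V then g z else 0) powr p))"
    by (auto simp: indicator_def)
  moreover have "(\<lambda>z. norm (if z \<in> V then g z else 0)) \<in> borel_measurable borel"
  proof -
    have "(\<lambda>z. norm (if z \<in> V then g z else 0)) = (\<lambda>z. if z \<in> V then norm (g z) else 0)"
      by auto
    then show ?thesis
      using V g by (auto intro!: borel_measurable_continuous_on_if continuous_intros)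
  qed
  ultimately show ?thesis
    using V by simp
qed

text \<open>One Cauchy integral over the circle of radius r in the i-th coordinate defines
  \<open>G\<close> at all points near a, using only values of g off the hyperplane. By Fubini almost
  every slice is in L^p of a punctured disc, so the one-variable growth bound makes its singularity
  removable and the integral reproduces g there. Continuity turns this almost everywhere identity
  into an identity off the hyperplane.\<close>

lemma Lp_extends_across_hyperplane_local:
  fixes g :: "complex ^ 'n \<Rightarrow> complex"
  assumes U: "open U" and g: "holo_fun_on g (U \<inter> {z. z $ i \<noteq> 0})" and p: "p > 2"
    and fin: "(\<integral>\<^sup>+z. indicator (U \<inter> {z. z $ i \<noteq> 0}) z * ennreal (cmod (g z) powr p) \<partial>lborel) < \<infinity>"
    and a: "a \<in> U" "a $ i = 0"
  obtains B G where "open B" "a \<in> B" "B \<subseteq> U" "holo_fun_on G B" "\<And>z. z \<in> B \<Longrightarrow> z $ i \<noteq> 0 \<Longrightarrow> G z = g z"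
proof -
  define V where "V = U \<inter> {z. z $ i \<noteq> 0}"
  have V: "open V" using U open_coordinate_nonzero unfolding V_def by blast
  have cg: "continuous_on V g" using holo_fun_on_continuous[OF g] by (simp add: V_def)
  obtain e where e: "e > 0" "ball a e \<subseteq> U" using U a(1) open_contains_ball by blast
  \<comment> \<open>For z within r of a, also |z_i| < r because a_i = 0. Replacing z_i by \<zeta>
    with |\<zeta>| < 2r moves z by less than 3r, so the result stays within 4r = e of a.\<close>
  define r where "r = e / 4"
  define B where "B = ball a r"
  have r: "r > 0" using e by (simp add: r_def)
  have zi: "cmod (z $ i) < r" if "z \<in> B" for z
  proof -
    have "cmod ((z - a) $ i) \<le> norm (z - a)" by (rule Finite_Cartesian_Product.norm_nth_le)
    then show ?thesis using that a by (simp add: B_def dist_norm norm_minus_commute)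
  qed
  have updU: "upd z i \<zeta> \<in> U" if "z \<in> B" "cmod \<zeta> < 2 * r" for z \<zeta>
  proof -
    have "dist a (upd z i \<zeta>) \<le> dist a z + dist z (upd z i \<zeta>)" by (rule dist_triangle)
    also have "dist z (upd z i \<zeta>) = cmod (\<zeta> - z $ i)"
      by (simp add: upd_eq_add dist_norm norm_axis_complex)
    also have "dist a z + cmod (\<zeta> - z $ i) < 4 * r"
      using that zi[OF that(1)] norm_triangle_ineq4[of \<zeta> "z $ i"] by (simp add: B_def)
    finally show ?thesis using e(2) by (auto simp: r_def)
  qed
  define c where "c t = r * cis (2 * pi * t)" for t
  have c: "cmod (c t) = r" for t using r by (simp add: c_def norm_mult)
  have c0: "c t \<noteq> 0" for t using c[of t] r by auto
  have cz: "c t - z $ i \<noteq> 0" if "z \<in> B" for z t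
    using zi[OF that] c[of t] by auto
  have updV: "upd z i (c t) \<in> V" if "z \<in> B" for z t
    using updU[OF that, of "c t"] r c0[of t] by (simp add: V_def c)
  have contc: "continuous_on S c" for S
    unfolding c_def[abs_def] cis_conv_exp by (intro continuous_intros)
  define \<phi> where "\<phi> z t = g (upd z i (c t)) * c t / (c t - z $ i)" for z t
  define G where "G z = integral {0..1} (\<phi> z)" for z
  have holG: "holo_fun_on G B"
    unfolding G_def[abs_def]
  proof (rule holo_fun_on_integral)
    show "open B" by (simp add: B_def)
    show "holo_fun_on (\<lambda>z. \<phi> z t) B" for t
      unfolding \<phi>_def
      by (intro holo_fun_on_divide holo_fun_on_mult holo_fun_on_diff holo_fun_on_const holo_fun_on_nth
          holo_fun_on_compose[OF g] holo_map_on_upd)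
         (use updV cz in \<open>auto simp: V_def\<close>)
    have c2: "continuous_on (B \<times> {0..1}) (\<lambda>x. c (snd x))"
      by (rule continuous_on_compose2[OF contc[of UNIV] continuous_on_snd[OF continuous_on_id]]) simp
    have "continuous_on (B \<times> {0..1}) (\<lambda>x. upd (fst x) i (c (snd x)))"
      by (intro continuous_on_upd c2 continuous_on_fst continuous_on_id)
    then have "continuous_on (B \<times> {0..1}) (\<lambda>x. g (upd (fst x) i (c (snd x))))"
      by (rule continuous_on_compose2[OF cg]) (use updV in auto)
    with c2 show "continuous_on (B \<times> {0..1}) (\<lambda>(z, t). \<phi> z t)"
      unfolding case_prod_beta \<phi>_def
      by (intro continuous_intros) (use cz in auto)
  qed
  define F :: "complex ^ 'n \<Rightarrow> ennreal" where "F z = indicator V z * ennreal (cmod (g z) powr p)" for z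
  have F [measurable]: "F \<in> borel_measurable borel"
    unfolding F_def[abs_def] by (rule measurable_norm_powr_on[OF V cg])
  obtain w :: "complex \<Rightarrow> ennreal" where w [measurable]: "w \<in> borel_measurable borel"
    and w1: "(\<integral>\<^sup>+\<zeta>. w \<zeta> \<partial>lborel) = 1" and w0: "\<And>\<zeta>. cmod \<zeta> < r \<Longrightarrow> w \<zeta> \<noteq> 0"
    using ex_prob_density_on_ball[OF r] by blast
  have "(\<integral>\<^sup>+z. w (z $ i) * (\<integral>\<^sup>+\<zeta>. F (upd z i \<zeta>) \<partial>lborel) \<partial>lborel) \<noteq> \<infinity>"
    using fin nn_integral_coordinate[OF F w w1, of i] by (simp add: F_def V_def)
  \<comment> \<open>The weight is nonzero at \<open>z $ i\<close> whenever z lies in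
    \<open>B\<close>, so finiteness of the product passes to the slice integral for almost every z
    in \<open>B\<close>.\<close>
  then have "AE z in lborel. w (z $ i) * (\<integral>\<^sup>+\<zeta>. F (upd z i \<zeta>) \<partial>lborel) \<noteq> \<infinity>"
    by (intro nn_integral_noteq_infinite) auto
  then have AE: "AE z in lborel. z \<in> B \<inter> V \<longrightarrow> G z = g z"
  proof eventually_elim
    case (elim z)
    show ?case
    proof
      assume z: "z \<in> B \<inter> V"
      define f where "f \<zeta> = g (upd z i \<zeta>)" for \<zeta>
      have inV: "upd z i \<zeta> \<in> V" if "\<zeta> \<in> ball 0 (2 * r) - {0}" for \<zeta>
        using updU z that by (auto simp: V_def)
      have "(\<integral>\<^sup>+\<zeta>. F (upd z i \<zeta>) \<partial>lborel) \<noteq> \<infinity>"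
        using elim w0[OF zi] z by (auto simp: ennreal_mult_eq_top_iff)
      moreover have "(\<integral>\<^sup>+\<zeta>. indicator (ball 0 (2 * r) - {0}) \<zeta> * ennreal (cmod (f \<zeta>) powr p) \<partial>lborel)
          \<le> (\<integral>\<^sup>+\<zeta>. F (upd z i \<zeta>) \<partial>lborel)"
      proof (rule nn_integral_mono)
        show "indicator (ball 0 (2 * r) - {0}) \<zeta> * ennreal (cmod (f \<zeta>) powr p) \<le> F (upd z i \<zeta>)" for \<zeta>
        proof (cases "\<zeta> \<in> ball 0 (2 * r) - {0}")
          case True
          from inV[OF this] True show ?thesis
            by (simp only: F_def f_def indicator_simps order_refl)
        next
          case False
          then have "indicator (ball 0 (2 * r) - {0}) \<zeta> = (0::ennreal)" by (rule indicator_simps(2))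
          then show ?thesis by simp
        qed
      qed
      ultimately have fin': "(\<integral>\<^sup>+\<zeta>. indicator (ball 0 (2 * r) - {0}) \<zeta> * ennreal (cmod (f \<zeta>) powr p) \<partial>lborel) < \<infinity>"
        by (simp only: order_le_less_trans top.not_eq_extremum infinity_ennreal_def)
      have f: "f holomorphic_on ball 0 (2 * r) - {0}"
        unfolding f_def by (rule holo_fun_on_slice[OF g]) (use inV in \<open>auto simp: V_def\<close>)
      have "((\<lambda>\<zeta>. \<zeta> * f \<zeta>) \<longlongrightarrow> 0) (at 0)"
        by (rule Lp_punctured_disc_growth[OF f _ p fin']) (use r in simp)
      then obtain h where h: "h holomorphic_on ball 0 (2 * r)" "\<And>\<zeta>. \<zeta> \<in> ball 0 (2 * r) - {0} \<Longrightarrow> h \<zeta> = f \<zeta>"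
        using holomorphic_on_extend_lim[OF f] r by (force simp: interior_open)
      have "G z = integral {0..1} (\<lambda>t. h (c t) * c t / (c t - z $ i))"
        unfolding G_def \<phi>_def
      proof (rule integral_cong)
        have "c t \<in> ball 0 (2 * r) - {0}" for t using c[of t] c0[of t] r by simp
        then show "g (upd z i (c t)) * c t / (c t - z $ i) = h (c t) * c t / (c t - z $ i)" for t
          using h(2) by (simp only: f_def)
      qed
      also have "\<dots> = h (z $ i)"
        unfolding c_def by (rule integral_unique[OF Cauchy_integral_circle[OF h(1)]]) (use r zi z in auto)
      also have "\<dots> = g z"
        using h(2)[of "z $ i"] z zi[of z] r by (simp add: f_def V_def)
      finally show "G z = g z" .
    qed
  qed
  have eq: "G z = g z" if "z \<in> B" "z $ i \<noteq> 0" for z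
  proof (rule continuous_AE_eq_imp_eq[OF _ _ _ AE])
    show "open (B \<inter> V)" using V by (auto simp: B_def)
    show "continuous_on (B \<inter> V) G"
      by (rule continuous_on_subset[OF holo_fun_on_continuous[OF holG]]) auto
    show "continuous_on (B \<inter> V) g"
      by (rule continuous_on_subset[OF cg]) auto
    show "z \<in> B \<inter> V" using that updU[of z "z $ i"] zi[of z] r by (simp add: V_def)
  qed
  have "B \<subseteq> U" using e r by (auto simp: B_def r_def)
  then show ?thesis
    using that[of B G] holG eq r by (simp add: B_def)
qed

lemma at_within_coordinate_nonzero_nontrivial:
  "at (z :: complex ^ 'n) within {w. w $ i \<noteq> 0} \<noteq> bot"
proof (cases "z $ i = 0")
  case True
  have "z islimpt {w. w $ i \<noteq> 0}"
    unfolding islimpt_approachable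
  proof (intro allI impI)
    fix e :: real assume "e > 0"
    then show "\<exists>w\<in>{w. w $ i \<noteq> 0}. w \<noteq> z \<and> dist w z < e"
      using True by (intro bexI[of _ "upd z i (of_real (e / 2))"])
        (auto simp: vec_eq_iff, simp add: upd_eq_add dist_norm norm_axis_complex norm_divide)
  qed
  then show ?thesis by (simp add: trivial_limit_within)
next
  case False
  then show ?thesis
    using at_within_open[OF _ open_coordinate_nonzero, of z i] by simp
qed

text \<open>On the hyperplane the value is taken to be the limit of g from the complement. Each
  local extension is continuous and hence agrees with this limit, so no compatibility between
  different local extensions has to be checked.\<close>

lemma Lp_extends_across_hyperplane:
  fixes g :: "complex ^ 'n \<Rightarrow> complex"
  assumes U: "open U" and g: "holo_fun_on g (U \<inter> {z. z $ i \<noteq> 0})" and p: "p > 2"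
    and fin: "(\<integral>\<^sup>+z. indicator (U \<inter> {z. z $ i \<noteq> 0}) z * ennreal (cmod (g z) powr p) \<partial>lborel) < \<infinity>"
  obtains G where "holo_fun_on G U" "\<And>z. z \<in> U \<Longrightarrow> z $ i \<noteq> 0 \<Longrightarrow> G z = g z"
proof -
  define G where "G z = (if z $ i \<noteq> 0 then g z else Lim (at z within {w. w $ i \<noteq> 0}) g)" for z
  have "\<exists>f'. (G has_derivative f') (at a) \<and> (\<forall>c v. f' (c *s v) = c * f' v)" if a: "a \<in> U" for a
  proof -
    have "\<exists>B. open B \<and> a \<in> B \<and> holo_fun_on G B"
    proof (cases "a $ i = 0")
      case True
      obtain B h where B: "open B" "a \<in> B" "B \<subseteq> U" "holo_fun_on h B" "\<And>z. z \<in> B \<Longrightarrow> z $ i \<noteq> 0 \<Longrightarrow> h z = g z"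
        using Lp_extends_across_hyperplane_local[OF U g p fin a True] by blast
      have "G z = h z" if z: "z \<in> B" for z
      proof (cases "z $ i = 0")
        case True
        have "(h \<longlongrightarrow> h z) (at z)"
          using holo_fun_on_continuous[OF B(4)] B(1) z
          by (simp add: continuous_on_eq_continuous_at isCont_def)
        then have "(h \<longlongrightarrow> h z) (at z within {w. w $ i \<noteq> 0})"
          using tendsto_within_subset subset_UNIV by blast
        moreover have "\<forall>\<^sub>F w in at z within {w. w $ i \<noteq> 0}. h w = g w"
          unfolding eventually_at_topological using B z by blast
        ultimately have "(g \<longlongrightarrow> h z) (at z within {w. w $ i \<noteq> 0})"
          by (rule Lim_transform_eventually)
        then show ?thesis
          using True tendsto_Lim[OF at_within_coordinate_nonzero_nontrivial] by (simp add: G_def)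
      qed (use B(5) z in \<open>simp add: G_def\<close>)
      then show ?thesis
        using B holo_fun_on_cong[OF B(4) B(1)] by blast
    next
      case False
      have "open (U \<inter> {z. z $ i \<noteq> 0})" using U open_coordinate_nonzero by blast
      then show ?thesis
        using holo_fun_on_cong[OF g, of G] a False by (intro exI[of _ "U \<inter> {z. z $ i \<noteq> 0}"]) (auto simp: G_def)
    qed
    then show ?thesis unfolding holo_fun_on_def by blast
  qed
  then have "holo_fun_on G U" unfolding holo_fun_on_def by blast
  then show ?thesis using that[of G] by (simp add: G_def)
qed

section \<open>Spaces of integrable holomorphic functions\<close>

text \<open>The p-th power of the norm as an extended nonnegative Borel integral, so that Fubini and
  changes of variables apply before integrability is known.\<close>

definition Lp_mass :: "real \<Rightarrow> (complex ^ 'n) set \<Rightarrow> (complex ^ 'n \<Rightarrow> complex) \<Rightarrow> ennreal" where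
  "Lp_mass p D \<phi> = (\<integral>\<^sup>+z. indicator D z * ennreal (cmod (\<phi> z) powr p) \<partial>lborel)"

text \<open>The integrand is Borel, so integrating over the completed measure
  \<open>lebesgue\<close> or over \<open>lborel\<close> makes no difference.\<close>

lemma
  fixes D :: "(complex ^ 'n) set"
  assumes D: "open D" and \<phi>: "continuous_on D \<phi>"
  shows set_integrable_iff_Lp_mass: "set_integrable lebesgue D (\<lambda>z. norm (\<phi> z) powr p) \<longleftrightarrow> Lp_mass p D \<phi> < \<infinity>"
    and Ap_norm_eq_Lp_mass: "Ap_norm p D \<phi> = enn2real (Lp_mass p D \<phi>) powr (1 / p)"
proof -
  define u where "u z = indicat_real D z *\<^sub>R (cmod (\<phi> z) powr p)" for z
  have h: "(\<lambda>z. indicator D z * ennreal (cmod (\<phi> z) powr p)) \<in> borel_measurable borel"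
    using D \<phi> by (rule measurable_norm_powr_on)
  have u0: "u z \<ge> 0" for z by (simp add: u_def)
  have eu: "ennreal (u z) = indicator D z * ennreal (cmod (\<phi> z) powr p)" for z
    by (simp add: u_def indicator_def)
  have u: "u \<in> borel_measurable borel"
  proof -
    have "(\<lambda>z. enn2real (ennreal (u z))) \<in> borel_measurable borel"
      unfolding eu using h by measurable
    then show ?thesis by (simp add: u0)
  qed
  have mass: "Lp_mass p D \<phi> = (\<integral>\<^sup>+z. ennreal (u z) \<partial>lborel)"
    by (simp add: Lp_mass_def eu)
  have "set_integrable lebesgue D (\<lambda>z. norm (\<phi> z) powr p) \<longleftrightarrow> integrable lborel u"
    unfolding set_integrable_def u_def[symmetric] using u by (intro integrable_completion) simp
  also have "\<dots> \<longleftrightarrow> Lp_mass p D \<phi> < \<infinity>"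
    using u u0 by (simp add: integrable_iff_bounded mass)
  finally show "set_integrable lebesgue D (\<lambda>z. norm (\<phi> z) powr p) \<longleftrightarrow> Lp_mass p D \<phi> < \<infinity>" .
  have "(LINT z:D|lebesgue. norm (\<phi> z) powr p) = integral\<^sup>L lborel u"
    unfolding set_lebesgue_integral_def u_def[symmetric] using u by (intro integral_completion) simp
  also have "\<dots> = enn2real (Lp_mass p D \<phi>)"
    unfolding mass using u u0 by (intro integral_eq_nn_integral) auto
  finally show "Ap_norm p D \<phi> = enn2real (Lp_mass p D \<phi>) powr (1 / p)"
    by (simp add: Ap_norm_def)
qed

lemma Ap_iff:
  assumes "open D"
  shows "\<phi> \<in> Ap p D \<longleftrightarrow> holo_fun_on \<phi> D \<and> (\<forall>z. z \<notin> D \<longrightarrow> \<phi> z = 0) \<and> Lp_mass p D \<phi> < \<infinity>"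
  using set_integrable_iff_Lp_mass[OF assms] holo_fun_on_continuous
  unfolding Ap_def by blast

lemma Ap_norm_Ap:
  assumes "open D" "\<phi> \<in> Ap p D"
  shows "Ap_norm p D \<phi> = enn2real (Lp_mass p D \<phi>) powr (1 / p)"
  using assms holo_fun_on_continuous by (intro Ap_norm_eq_Lp_mass) (auto simp: Ap_def)

lemma Lp_mass_measurable:
  assumes "open D" "holo_fun_on \<phi> D"
  shows "(\<lambda>z. indicator D z * ennreal (cmod (\<phi> z) powr p)) \<in> borel_measurable borel"
  using assms by (intro measurable_norm_powr_on holo_fun_on_continuous)

lemma Lp_mass_cong: "(\<And>z. z \<in> D \<Longrightarrow> \<phi> z = \<psi> z) \<Longrightarrow> Lp_mass p D \<phi> = Lp_mass p D \<psi>"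
  unfolding Lp_mass_def by (intro nn_integral_cong) (auto simp: indicator_def)

text \<open>Rests on |a + b|^p \<le> (2 max(|a|, |b|))^p. Closure under sums is needed for inverting
  an isometry: the sum of two preimages has to lie in the space before it can be recognised as the
  preimage of the sum.\<close>

lemma Ap_add:
  assumes D: "open D" and p: "p \<ge> 0" and \<phi>: "\<phi> \<in> Ap p D" and \<psi>: "\<psi> \<in> Ap p D"
  shows "(\<lambda>z. \<phi> z + \<psi> z) \<in> Ap p D"
  unfolding Ap_iff[OF D]
proof (intro conjI)
  note \<phi>' = \<phi>[unfolded Ap_iff[OF D]] and \<psi>' = \<psi>[unfolded Ap_iff[OF D]]
  show "holo_fun_on (\<lambda>z. \<phi> z + \<psi> z) D" using \<phi>' \<psi>' by (auto intro: holo_fun_on_add)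
  show "\<forall>z. z \<notin> D \<longrightarrow> \<phi> z + \<psi> z = 0" using \<phi>' \<psi>' by auto
  have bound: "cmod (a + b) powr p \<le> 2 powr p * cmod a powr p + 2 powr p * cmod b powr p" for a b
  proof -
    have "cmod (a + b) \<le> 2 * max (cmod a) (cmod b)"
      using norm_triangle_ineq[of a b] by (auto simp: max_def)
    then have "cmod (a + b) powr p \<le> (2 * max (cmod a) (cmod b)) powr p"
      using p by (intro powr_mono2) auto
    also have "\<dots> \<le> 2 powr p * cmod a powr p + 2 powr p * cmod b powr p"
      by (auto simp: powr_mult max_def)
    finally show ?thesis .
  qed
  have "Lp_mass p D (\<lambda>z. \<phi> z + \<psi> z)
      \<le> (\<integral>\<^sup>+z. ennreal (2 powr p) * (indicator D z * ennreal (cmod (\<phi> z) powr p))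
          + ennreal (2 powr p) * (indicator D z * ennreal (cmod (\<psi> z) powr p)) \<partial>lborel)"
    unfolding Lp_mass_def
  proof (rule nn_integral_mono)
    fix z
    show "indicator D z * ennreal (cmod (\<phi> z + \<psi> z) powr p)
      \<le> ennreal (2 powr p) * (indicator D z * ennreal (cmod (\<phi> z) powr p))
          + ennreal (2 powr p) * (indicator D z * ennreal (cmod (\<psi> z) powr p))"
      using ennreal_leI[OF bound[of "\<phi> z" "\<psi> z"]]
      by (cases "z \<in> D") (simp_all add: ennreal_mult)
  qed
  also have "\<dots> = ennreal (2 powr p) * Lp_mass p D \<phi> + ennreal (2 powr p) * Lp_mass p D \<psi>"
    using Lp_mass_measurable[OF D, of \<phi>] Lp_mass_measurable[OF D, of \<psi>] \<phi>' \<psi>'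
    by (simp add: nn_integral_add nn_integral_cmult Lp_mass_def)
  also have "\<dots> < \<infinity>" using \<phi>' \<psi>' by (simp add: ennreal_mult_less_top)
  finally show "Lp_mass p D (\<lambda>z. \<phi> z + \<psi> z) < \<infinity>" .
qed

lemma Ap_scale:
  assumes D: "open D" and \<phi>: "\<phi> \<in> Ap p D"
  shows "(\<lambda>z. c * \<phi> z) \<in> Ap p D"
  unfolding Ap_iff[OF D]
proof (intro conjI)
  note \<phi>' = \<phi>[unfolded Ap_iff[OF D]]
  show "holo_fun_on (\<lambda>z. c * \<phi> z) D" using \<phi>' by (auto intro: holo_fun_on_mult holo_fun_on_const)
  show "\<forall>z. z \<notin> D \<longrightarrow> c * \<phi> z = 0" using \<phi>' by auto
  have "Lp_mass p D (\<lambda>z. c * \<phi> z) = (\<integral>\<^sup>+z. ennreal (cmod c powr p) * (indicator D z * ennreal (cmod (\<phi> z) powr p)) \<partial>lborel)"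
    unfolding Lp_mass_def
    by (intro nn_integral_cong) (simp add: norm_mult powr_mult ennreal_mult mult_ac)
  also have "\<dots> = ennreal (cmod c powr p) * Lp_mass p D \<phi>"
    using Lp_mass_measurable[OF D, of \<phi>] \<phi>' by (simp add: nn_integral_cmult Lp_mass_def)
  also have "\<dots> < \<infinity>" using \<phi>' by (simp add: ennreal_mult_less_top)
  finally show "Lp_mass p D (\<lambda>z. c * \<phi> z) < \<infinity>" .
qed

section \<open>Isometries between the spaces, completeness and the shear\<close>

lemma
  assumes T: "Ap_isometry p D E T"
  shows Ap_isometry_bij: "bij_betw T (Ap p D) (Ap p E)"
    and Ap_isometry_mem: "\<phi> \<in> Ap p D \<Longrightarrow> T \<phi> \<in> Ap p E"
    and Ap_isometry_add: "\<phi> \<in> Ap p D \<Longrightarrow> \<psi> \<in> Ap p D \<Longrightarrow> T (\<lambda>z. \<phi> z + \<psi> z) = (\<lambda>w. T \<phi> w + T \<psi> w)"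
    and Ap_isometry_scale: "\<phi> \<in> Ap p D \<Longrightarrow> T (\<lambda>z. c * \<phi> z) = (\<lambda>w. c * T \<phi> w)"
    and Ap_isometry_norm: "\<phi> \<in> Ap p D \<Longrightarrow> Ap_norm p E (T \<phi>) = Ap_norm p D \<phi>"
proof -
  show bij: "bij_betw T (Ap p D) (Ap p E)" using T unfolding Ap_isometry_def by blast
  show "\<phi> \<in> Ap p D \<Longrightarrow> T \<phi> \<in> Ap p E" using bij by (rule bij_betwE[rule_format])
  show "\<phi> \<in> Ap p D \<Longrightarrow> \<psi> \<in> Ap p D \<Longrightarrow> T (\<lambda>z. \<phi> z + \<psi> z) = (\<lambda>w. T \<phi> w + T \<psi> w)"
    using T unfolding Ap_isometry_def by blast
  show "\<phi> \<in> Ap p D \<Longrightarrow> T (\<lambda>z. c * \<phi> z) = (\<lambda>w. c * T \<phi> w)"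
    using T unfolding Ap_isometry_def by blast
  show "\<phi> \<in> Ap p D \<Longrightarrow> Ap_norm p E (T \<phi>) = Ap_norm p D \<phi>"
    using T unfolding Ap_isometry_def by blast
qed

lemma Ap_isometry_compose:
  assumes S: "Ap_isometry p D E S" and T: "Ap_isometry p E F T"
  shows "Ap_isometry p D F (\<lambda>\<phi>. T (S \<phi>))"
  unfolding Ap_isometry_def
proof (intro conjI ballI allI)
  show "bij_betw (\<lambda>\<phi>. T (S \<phi>)) (Ap p D) (Ap p F)"
    using bij_betw_trans[OF Ap_isometry_bij[OF S] Ap_isometry_bij[OF T]] by (simp only: o_def)
  fix \<phi> assume \<phi>: "\<phi> \<in> Ap p D"
  note S\<phi> = Ap_isometry_mem[OF S \<phi>]
  show "T (S (\<lambda>z. c * \<phi> z)) = (\<lambda>w. c * T (S \<phi>) w)" for c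
    by (simp only: Ap_isometry_scale[OF S \<phi>] Ap_isometry_scale[OF T S\<phi>])
  show "Ap_norm p F (T (S \<phi>)) = Ap_norm p D \<phi>"
    by (simp only: Ap_isometry_norm[OF S \<phi>] Ap_isometry_norm[OF T S\<phi>])
  show "T (S (\<lambda>z. \<phi> z + \<psi> z)) = (\<lambda>w. T (S \<phi>) w + T (S \<psi>) w)" if \<psi>: "\<psi> \<in> Ap p D" for \<psi>
    by (simp only: Ap_isometry_add[OF S \<phi> \<psi>] Ap_isometry_add[OF T S\<phi> Ap_isometry_mem[OF S \<psi>]])
qed

lemma Ap_isometry_inv_into:
  assumes T: "Ap_isometry p D E T" and D: "open D" and p: "p \<ge> 0"
  shows "Ap_isometry p E D (inv_into (Ap p D) T)"
proof -
  let ?T' = "inv_into (Ap p D) T"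
  note bij = Ap_isometry_bij[OF T]
  have mem: "?T' \<phi> \<in> Ap p D" if "\<phi> \<in> Ap p E" for \<phi>
    using bij_betw_inv_into[OF bij] that by (rule bij_betwE[rule_format])
  have TT: "T (?T' \<phi>) = \<phi>" if "\<phi> \<in> Ap p E" for \<phi>
    using bij that by (rule bij_betw_inv_into_right)
  have eqI: "?T' \<phi> = \<psi>" if "T \<psi> = \<phi>" "\<psi> \<in> Ap p D" for \<phi> \<psi>
    using bij_betw_inv_into_left[OF bij that(2)] that(1) by simp
  show ?thesis
    unfolding Ap_isometry_def
  proof (intro conjI ballI allI)
    show "bij_betw ?T' (Ap p E) (Ap p D)" by (rule bij_betw_inv_into[OF bij])
    fix \<phi> assume \<phi>: "\<phi> \<in> Ap p E"
    show "?T' (\<lambda>z. \<phi> z + \<psi> z) = (\<lambda>w. ?T' \<phi> w + ?T' \<psi> w)" if \<psi>: "\<psi> \<in> Ap p E" for \<psi>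
      by (intro eqI Ap_add D p mem \<phi> \<psi>) (simp only: Ap_isometry_add[OF T mem[OF \<phi>] mem[OF \<psi>]] TT \<phi> \<psi>)
    show "?T' (\<lambda>z. c * \<phi> z) = (\<lambda>w. c * ?T' \<phi> w)" for c
      by (intro eqI Ap_scale D mem \<phi>) (simp only: Ap_isometry_scale[OF T mem[OF \<phi>]] TT \<phi>)
    show "Ap_norm p D (?T' \<phi>) = Ap_norm p E \<phi>"
      using Ap_isometry_norm[OF T mem[OF \<phi>]] by (simp only: TT[OF \<phi>])
  qed
qed

text \<open>Since D is bounded, the constant 1 belongs to A^p(D), and this single function is the
  whole test of completeness.\<close>

lemma Ap_complete_if_interior_closure:
  assumes D: "open D" "D \<noteq> {}" "bounded D" and reg: "interior (closure D) = D" and p: "p > 0"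
  shows "Ap_complete p D"
  unfolding Ap_complete_def
proof
  assume "\<exists>E. domain_Cn E \<and> D \<subset> E \<and> Ap_isometry p E D (restrict0 D)"
  then obtain E where E: "open E" "connected E" and DE: "D \<subset> E" and iso: "Ap_isometry p E D (restrict0 D)"
    unfolding domain_Cn_def by blast
  define one where "one = restrict0 D (\<lambda>_. 1 :: complex)"
  have "Lp_mass p D one = emeasure lborel D"
  proof -
    have "Lp_mass p D one = (\<integral>\<^sup>+z. indicator D z \<partial>lborel)"
      unfolding Lp_mass_def by (intro nn_integral_cong) (simp add: one_def restrict0_def indicator_def)
    then show ?thesis using D(1) by simp
  qed
  then have "Lp_mass p D one < \<infinity>"
    using emeasure_bounded_finite[OF D(3)] by simp
  moreover have "holo_fun_on one D"
    by (rule holo_fun_on_cong[OF holo_fun_on_const D(1)]) (simp add: one_def restrict0_def)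
  ultimately have one: "one \<in> Ap p D"
    unfolding Ap_iff[OF D(1)] by (simp add: one_def restrict0_def)
  then have "one \<in> restrict0 D ` Ap p E"
    using bij_betw_imp_surj_on[OF Ap_isometry_bij[OF iso]] by simp
  then obtain \<phi> where \<phi>: "\<phi> \<in> Ap p E" and \<phi>1: "restrict0 D \<phi> = one"
    by (elim imageE) simp
  have \<phi>D: "\<phi> z = 1" if "z \<in> D" for z
    using fun_cong[OF \<phi>1, of z] that by (simp add: one_def restrict0_def)
  have hol: "holo_fun_on \<phi> E" and fin: "Lp_mass p E \<phi> < \<infinity>"
    using \<phi> by (simp_all add: Ap_iff[OF E(1)])
  have cont: "continuous_on E \<phi>" by (rule holo_fun_on_continuous[OF hol])
  have "Ap_norm p D one = Ap_norm p E \<phi>"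
    using Ap_isometry_norm[OF iso \<phi>] by (simp only: \<phi>1)
  \<comment> \<open>Equal norms are turned into equal masses: the power p undoes the root, and as
    \<open>enn2real\<close> sends infinity to 0, finiteness of both masses is used to get back to
    \<open>ennreal\<close>.\<close>
  then have "(enn2real (Lp_mass p D one) powr (1 / p)) powr p = (enn2real (Lp_mass p E \<phi>) powr (1 / p)) powr p"
    by (simp only: Ap_norm_Ap[OF D(1) one] Ap_norm_Ap[OF E(1) \<phi>])
  then have "enn2real (Lp_mass p D one) = enn2real (Lp_mass p E \<phi>)"
    using p by (simp add: powr_powr)
  moreover have "ennreal (enn2real (Lp_mass p D one)) = Lp_mass p D one"
    using \<open>Lp_mass p D one < \<infinity>\<close> by (intro ennreal_enn2real) simp
  moreover have "ennreal (enn2real (Lp_mass p E \<phi>)) = Lp_mass p E \<phi>"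
    using fin by (intro ennreal_enn2real) simp
  ultimately have mass: "Lp_mass p E \<phi> = Lp_mass p D one"
    by metis
  define h where "h z = indicator E z * ennreal (cmod (\<phi> z) powr p)" for z
  have h [measurable]: "h \<in> borel_measurable borel"
    unfolding h_def[abs_def] by (rule Lp_mass_measurable[OF E(1) hol])
  have Dm: "D \<in> sets borel" using D by simp
  have "Lp_mass p E \<phi> = (\<integral>\<^sup>+z. indicator D z * ennreal (cmod (one z) powr p) + indicator (- D) z * h z \<partial>lborel)"
    unfolding Lp_mass_def
  proof (intro nn_integral_cong)
    fix z
    show "indicator E z * ennreal (cmod (\<phi> z) powr p)
        = indicator D z * ennreal (cmod (one z) powr p) + indicator (- D) z * h z"
    proof (cases "z \<in> D")
      case True
      with DE have "z \<in> E" by blast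
      with True show ?thesis by (simp add: one_def restrict0_def \<phi>D)
    qed (simp add: h_def)
  qed
  also have "\<dots> = Lp_mass p D one + (\<integral>\<^sup>+z. indicator (- D) z * h z \<partial>lborel)"
    unfolding Lp_mass_def
    by (rule nn_integral_add) (use Lp_mass_measurable[OF D(1) \<open>holo_fun_on one D\<close>] Dm h in simp_all)
  finally have "(\<integral>\<^sup>+z. indicator (- D) z * h z \<partial>lborel) = 0"
    using mass \<open>Lp_mass p D one < \<infinity>\<close> by auto
  then have "AE z in lborel. indicator (- D) z * h z = 0"
    by (rule nn_integral_0_iff_AE[THEN iffD1, rotated]) (use Dm h in measurable)
  then have AE: "AE z in lborel. z \<in> E - closure D \<longrightarrow> \<phi> z = 0"
  proof eventually_elim
    case (elim z)
    show ?case
    proof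
      assume z: "z \<in> E - closure D"
      then have "z \<in> - D" using closure_subset by blast
      with elim z show "\<phi> z = 0" by (simp add: h_def)
    qed
  qed
  have out: "\<phi> z = 0" if "z \<in> E - closure D" for z
  proof (rule continuous_AE_eq_imp_eq[OF _ _ _ AE that])
    show "continuous_on (E - closure D) \<phi>" using cont by (rule continuous_on_subset) blast
  qed (use E in auto)
  have "closedin (top_of_set E) (E \<inter> \<phi> -` {1})"
    using cont by (intro continuous_closedin_preimage) auto
  then obtain C where C: "closed C" "E \<inter> \<phi> -` {1} = E \<inter> C"
    by (auto simp: closedin_closed)
  have "D \<subseteq> E \<inter> \<phi> -` {1}" using DE \<phi>D by auto
  then have "closure D \<subseteq> C" using C by (intro closure_minimal) auto
  then have inn: "\<phi> z = 1" if "z \<in> E" "z \<in> closure D" for z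
    using C(2) that by auto
  \<comment> \<open>On E the function is 1 on the closure of D and 0 off it, so the relatively
    closed part of E inside the closure is also its nonvanishing set and thereby open.\<close>
  have "open (E \<inter> \<phi> -` (- {0}))"
    using cont E(1) by (intro continuous_open_preimage) auto
  moreover have "E \<inter> \<phi> -` (- {0}) = E \<inter> closure D"
    using out inn by auto
  ultimately have "open (E \<inter> closure D)" by simp
  moreover have "open (E - closure D)" using E(1) by auto
  moreover have "E \<inter> closure D \<noteq> {}" using D(2) DE closure_subset[of D] by auto
  ultimately have "E - closure D = {}"
    using connectedD[OF E(2), of "E \<inter> closure D" "E - closure D"] by auto
  then have "E \<subseteq> interior (closure D)"
    using E(1) by (intro interior_maximal) auto
  then show False using reg DE by auto
qed

text \<open>The operator is written from the unsheared set to the sheared one, that is, as the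
  inverse of the weighted pull-back. Since pm = 2k, the factor |z_i^m|^p is exactly the Jacobian
  |z_i|^(2k). Surjectivity is where p > 2 enters: the pulled back function is defined only off {z_i
  = 0} and must be extended to all of \<open>W\<close>.\<close>

lemma shear_isometry:
  fixes W :: "(complex ^ 'n) set" and i j :: 'n and k m :: nat and p :: real
  defines "D \<equiv> {w. w $ i \<noteq> 0 \<and> upd w j (w $ j / w $ i ^ k) \<in> W}"
  assumes W: "open W" and ij: "i \<noteq> j" and p: "p > 2" and pm: "p * real m = 2 * real k"
  shows "Ap_isometry p W D (\<lambda>\<psi> w. if w \<in> D then \<psi> (upd w j (w $ j / w $ i ^ k)) / w $ i ^ m else 0)"
    and "open D"
proof -
  define S where "S z = upd z j (z $ i ^ k * z $ j)" for z :: "complex ^ 'n"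
  define S' where "S' w = upd w j (w $ j / w $ i ^ k)" for w :: "complex ^ 'n"
  define R where "R \<psi> w = (if w \<in> D then \<psi> (S' w) / w $ i ^ m else 0)" for \<psi> :: "complex ^ 'n \<Rightarrow> complex" and w
  let ?V = "W \<inter> {z. z $ i \<noteq> 0}"
  have D: "w \<in> D \<longleftrightarrow> w $ i \<noteq> 0 \<and> S' w \<in> W" for w by (simp add: D_def S'_def)
  have SS': "S (S' w) = w" "S' w $ i = w $ i" if "w $ i \<noteq> 0" for w
    using that ij by (simp_all add: S_def S'_def)
  have S'S: "S' (S z) = z" "S z $ i = z $ i" if "z $ i \<noteq> 0" for z
    using that ij by (simp_all add: S_def S'_def)
  have SD: "S z \<in> D \<longleftrightarrow> z \<in> W" if "z $ i \<noteq> 0" for z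
    using that by (simp add: D S'S)
  have hS': "holo_map_on S' {w. w $ i \<noteq> 0}"
    unfolding S'_def[abs_def]
    by (intro holo_map_on_upd holo_fun_on_divide holo_fun_on_nth holo_fun_on_power) simp
  have hS: "holo_map_on S A" for A
    unfolding S_def[abs_def]
    by (intro holo_map_on_upd holo_fun_on_mult holo_fun_on_nth holo_fun_on_power)
  have Deq: "D = {w. w $ i \<noteq> 0} \<inter> S' -` W" using D by auto
  show oD: "open D"
    unfolding Deq by (rule continuous_open_preimage[OF holo_map_on_continuous[OF hS'] open_coordinate_nonzero W])
  have mass: "Lp_mass p D F = Lp_mass p ?V (\<lambda>z. z $ i ^ m * F (S z))" if F: "holo_fun_on F D" for F
  proof -
    have "Lp_mass p D F = (\<integral>\<^sup>+z. ennreal (cmod (z $ i) ^ (2 * k)) * (indicator D (S z) * ennreal (cmod (F (S z)) powr p)) \<partial>lborel)"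
      unfolding Lp_mass_def S_def by (rule nn_integral_shear[OF Lp_mass_measurable[OF oD F] ij])
    also have "\<dots> = Lp_mass p ?V (\<lambda>z. z $ i ^ m * F (S z))"
      unfolding Lp_mass_def
    proof (intro nn_integral_cong_AE, use AE_coordinate_nonzero[of i] in eventually_elim)
      case (elim z)
      have "cmod (z $ i ^ m) powr p = cmod (z $ i) powr (real m * p)"
        using elim by (simp add: norm_power powr_powr flip: powr_realpow)
      also have "\<dots> = cmod (z $ i) ^ (2 * k)"
        using elim pm by (simp add: mult.commute flip: powr_realpow)
      finally have "cmod (z $ i ^ m * F (S z)) powr p = cmod (z $ i) ^ (2 * k) * cmod (F (S z)) powr p"
        by (simp add: norm_mult powr_mult)
      then show ?case
        using elim SD[OF elim] by (simp add: indicator_def ennreal_mult)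
    qed
    finally show ?thesis .
  qed
  have massV: "Lp_mass p ?V F = Lp_mass p W F" for F
    unfolding Lp_mass_def
    by (intro nn_integral_cong_AE, use AE_coordinate_nonzero[of i] in eventually_elim) (simp add: indicator_def)
  have hR: "holo_fun_on (R \<psi>) D" and mR: "Lp_mass p D (R \<psi>) = Lp_mass p W \<psi>" if \<psi>: "holo_fun_on \<psi> W" for \<psi>
  proof -
    have "holo_fun_on (\<lambda>w. \<psi> (S' w) / w $ i ^ m) D"
      by (intro holo_fun_on_divide holo_fun_on_compose[OF \<psi>] holo_fun_on_power holo_fun_on_nth
            holo_map_on_subset[OF hS']) (use D in auto)
    then show hR: "holo_fun_on (R \<psi>) D"
      by (rule holo_fun_on_cong[OF _ oD]) (simp add: R_def)
    have "Lp_mass p ?V (\<lambda>z. z $ i ^ m * R \<psi> (S z)) = Lp_mass p ?V \<psi>"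
      by (rule Lp_mass_cong) (auto simp: R_def SD S'S)
    then show "Lp_mass p D (R \<psi>) = Lp_mass p W \<psi>"
      unfolding mass[OF hR] massV[symmetric] .
  qed
  have RA: "R \<psi> \<in> Ap p D" if "\<psi> \<in> Ap p W" for \<psi>
    using that hR mR by (simp add: Ap_iff[OF oD] Ap_iff[OF W]) (simp add: R_def)
  \<comment> \<open>\<open>R\<close> sees only the values off {z_i = 0}; continuity recovers the
    others.\<close>
  have "inj_on R (Ap p W)"
  proof (rule inj_onI)
    fix \<psi> \<psi>' assume \<psi>: "\<psi> \<in> Ap p W" and \<psi>': "\<psi>' \<in> Ap p W" and eq: "R \<psi> = R \<psi>'"
    have eqV: "\<psi> z = \<psi>' z" if "z \<in> W" "z $ i \<noteq> 0" for z
      using fun_cong[OF eq, of "S z"] that by (simp add: R_def SD S'S)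
    have AE: "AE z in lborel. z \<in> W \<longrightarrow> \<psi> z = \<psi>' z"
      using AE_coordinate_nonzero[of i] by eventually_elim (use eqV in auto)
    have "\<psi> z = \<psi>' z" for z
    proof (cases "z \<in> W")
      case True
      show ?thesis
        by (rule continuous_AE_eq_imp_eq[OF W _ _ AE True])
           (use \<psi> \<psi>' holo_fun_on_continuous in \<open>auto simp: Ap_iff[OF W]\<close>)
    qed (use \<psi> \<psi>' in \<open>auto simp: Ap_iff[OF W]\<close>)
    then show "\<psi> = \<psi>'" by auto
  qed
  moreover have "\<phi> \<in> R ` Ap p W" if \<phi>: "\<phi> \<in> Ap p D" for \<phi>
  proof -
    have h\<phi>: "holo_fun_on \<phi> D" and f\<phi>: "Lp_mass p D \<phi> < \<infinity>" and z\<phi>: "\<And>w. w \<notin> D \<Longrightarrow> \<phi> w = 0"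
      using \<phi> by (auto simp: Ap_iff[OF oD])
    define g where "g z = z $ i ^ m * \<phi> (S z)" for z
    have hg: "holo_fun_on g ?V"
      unfolding g_def[abs_def]
      by (intro holo_fun_on_mult holo_fun_on_power holo_fun_on_nth holo_fun_on_compose[OF h\<phi> hS]) (use SD in auto)
    have fg: "Lp_mass p ?V g < \<infinity>"
      using f\<phi> mass[OF h\<phi>] by (simp add: g_def[abs_def])
    obtain G where G: "holo_fun_on G W" "\<And>z. z \<in> W \<Longrightarrow> z $ i \<noteq> 0 \<Longrightarrow> G z = g z"
      using Lp_extends_across_hyperplane[OF W hg p fg[unfolded Lp_mass_def]] by blast
    define \<psi> where "\<psi> = restrict0 W G"
    have h\<psi>: "holo_fun_on \<psi> W"
      by (rule holo_fun_on_cong[OF G(1) W]) (simp add: \<psi>_def restrict0_def)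
    have "Lp_mass p W \<psi> = Lp_mass p ?V g"
      unfolding massV[symmetric] by (rule Lp_mass_cong) (simp add: \<psi>_def restrict0_def G)
    then have "\<psi> \<in> Ap p W"
      using fg h\<psi> by (simp add: Ap_iff[OF W]) (simp add: \<psi>_def restrict0_def)
    moreover have "R \<psi> w = \<phi> w" for w
    proof (cases "w \<in> D")
      case True
      then show ?thesis
        using D[of w] SS'[of w] by (simp add: R_def \<psi>_def restrict0_def G g_def)
    qed (simp add: R_def z\<phi>)
    then have "\<phi> = R \<psi>" by auto
    ultimately show ?thesis by blast
  qed
  ultimately have "bij_betw R (Ap p W) (Ap p D)"
    using RA by (auto simp: bij_betw_def)
  moreover have "Ap_norm p D (R \<psi>) = Ap_norm p W \<psi>" if "\<psi> \<in> Ap p W" for \<psi>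
    unfolding Ap_norm_Ap[OF oD RA[OF that]] Ap_norm_Ap[OF W that]
    using mR that by (simp add: Ap_iff[OF W])
  moreover have "R (\<lambda>z. \<phi> z + \<psi> z) = (\<lambda>w. R \<phi> w + R \<psi> w)" for \<phi> \<psi>
    by (auto simp: R_def add_divide_distrib)
  moreover have "R (\<lambda>z. c * \<phi> z) = (\<lambda>w. c * R \<phi> w)" for c \<phi>
    by (auto simp: R_def)
  ultimately have "Ap_isometry p W D R"
    unfolding Ap_isometry_def by blast
  then show "Ap_isometry p W D (\<lambda>\<psi> w. if w \<in> D then \<psi> (upd w j (w $ j / w $ i ^ k)) / w $ i ^ m else 0)"
    unfolding R_def[abs_def] S'_def .
qed

section \<open>Automorphisms of the product of the ball and the bidisc\<close>

text \<open>Complex-linear, without conjugation, so that composing with it keeps holomorphy.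
  Schwarz' lemma and the maximum principle are applied to such scalar components of a map.\<close>

definition lin :: "complex ^ 'n \<Rightarrow> complex ^ 'n \<Rightarrow> complex" where
  "lin d z = (\<Sum>i\<in>UNIV. d $ i * z $ i)"

lemma lin_axis [simp]: "lin (axis i 1) z = z $ i"
proof -
  have "(\<Sum>l\<in>UNIV. axis i 1 $ l * z $ l) = (\<Sum>l\<in>UNIV. if l = i then z $ l else 0)"
    by (intro sum.cong) (auto simp: axis_def)
  then show ?thesis by (simp add: lin_def)
qed

lemma lin_smult: "lin d (c *s z) = c * lin d z"
  by (simp add: lin_def sum_distrib_left mult_ac)

lemma lin_zero [simp]: "lin d 0 = 0"
  by (simp add: lin_def)

lemma bounded_linear_lin: "bounded_linear (lin d)"
  unfolding lin_def[abs_def]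
  by (rule bounded_linear_sum) (rule bounded_linear_const_mult[OF bounded_linear_vec_nth])

lemma holo_fun_on_lin:
  assumes "holo_map_on F D"
  shows "holo_fun_on (\<lambda>z. lin d (F z)) D"
  unfolding lin_def
  by (intro holo_fun_on_sum holo_fun_on_mult holo_fun_on_const)
     (use assms in \<open>auto simp: holo_map_on_def\<close>)

text \<open>Restricted to the line through c, the functional of g is a holomorphic self-map of the
  disc fixing 0, and its derivative at 0 is the functional of g'(c).\<close>

lemma Schwarz_derivative_on_line:
  fixes g :: "complex ^ 'n \<Rightarrow> complex ^ 'm"
  assumes g: "holo_map_on g Q" and g': "(g has_derivative g') (at 0)" "\<And>c v. g' (c *s v) = c *s g' v"
    and g0: "g 0 = 0"
    and line: "\<And>\<zeta>. cmod \<zeta> < 1 \<Longrightarrow> \<zeta> *s c \<in> Q" "\<And>\<zeta>. cmod \<zeta> < 1 \<Longrightarrow> cmod (lin d (g (\<zeta> *s c))) < 1"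
  shows "cmod (lin d (g' c)) \<le> 1"
proof -
  define f where "f \<zeta> = lin d (g (0 + \<zeta> *s c))" for \<zeta>
  have hol: "f holomorphic_on ball 0 1"
    unfolding f_def using line(1) by (intro holo_fun_on_line[OF holo_fun_on_lin[OF g]]) auto
  have "((\<lambda>z. lin d (g z)) has_derivative (\<lambda>v. lin d (g' v))) (at (0 + 0 *s c))"
    using bounded_linear.has_derivative[OF bounded_linear_lin g'(1)] by simp
  then have "(f has_field_derivative lin d (g' c)) (at 0)"
    unfolding f_def[abs_def] by (rule has_field_derivative_on_line) (simp add: g'(2) lin_smult)
  then have "deriv f 0 = lin d (g' c)" by (rule DERIV_imp_deriv)
  moreover have "cmod (deriv f 0) \<le> 1"
    by (rule Schwarz_Lemma(2)[OF hol, of 0]) (use line(2) g0 in \<open>auto simp: f_def\<close>)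
  ultimately show ?thesis by simp
qed

text \<open>On a small circle around 0, which avoids the puncture, |f| attains its maximum; that
  value is less than 1, and the maximum principle carries the strict bound to the centre.\<close>

lemma cmod_less_1_at_puncture:
  assumes f: "f holomorphic_on S" and S: "open S" "(0::complex) \<in> S"
    and lt: "\<And>\<zeta>. \<zeta> \<in> S \<Longrightarrow> \<zeta> \<noteq> 0 \<Longrightarrow> cmod (f \<zeta>) < 1"
  shows "cmod (f 0) < 1"
proof -
  obtain r where r: "r > 0" "cball 0 r \<subseteq> S" using S open_contains_cball by blast
  have fc: "f holomorphic_on cball 0 r" using f r(2) by (rule holomorphic_on_subset)
  have cf: "continuous_on (cball 0 r) f" by (rule holomorphic_on_imp_continuous_on[OF fc])
  have sph: "compact (sphere (0::complex) r)" "sphere (0::complex) r \<noteq> {}" using r by auto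
  have cs: "continuous_on (sphere 0 r) (\<lambda>\<zeta>. cmod (f \<zeta>))"
    by (intro continuous_on_norm continuous_on_subset[OF cf] sphere_cball)
  obtain \<xi> where \<xi>: "\<xi> \<in> sphere 0 r" "\<And>\<zeta>. \<zeta> \<in> sphere 0 r \<Longrightarrow> cmod (f \<zeta>) \<le> cmod (f \<xi>)"
    using continuous_attains_sup[OF sph cs] by blast
  have "cmod (f 0) \<le> cmod (f \<xi>)"
  proof (rule maximum_modulus_frontier[of f "cball 0 r"])
    show "f holomorphic_on interior (cball 0 r)"
      by (rule holomorphic_on_subset[OF fc interior_subset])
    show "continuous_on (closure (cball 0 r)) f" using cf by simp
    show "cmod (f z) \<le> cmod (f \<xi>)" if "z \<in> frontier (cball 0 r)" for z
      using that r \<xi>(2) by simp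
  qed (use r in auto)
  also have "\<dots> < 1" proof (rule lt)
    show "\<xi> \<in> S" using \<xi>(1) r(2) sphere_cball by blast
    show "\<xi> \<noteq> 0" using \<xi>(1) r(1) by auto
  qed
  finally show ?thesis .
qed

definition ball_times_bidisc :: "(complex ^ 4) set" where
  "ball_times_bidisc = {z. (cmod (z $ 1))\<^sup>2 + (cmod (z $ 2))\<^sup>2 < 1 \<and> cmod (z $ 3) < 1 \<and> cmod (z $ 4) < 1}"

lemma open_ball_times_bidisc: "open ball_times_bidisc"
  unfolding ball_times_bidisc_def
  by (intro open_Collect_conj open_Collect_less continuous_intros)

lemma nth_less_1_ball_times_bidisc:
  assumes "z \<in> ball_times_bidisc"
  shows "cmod (z $ i) < 1"
proof -
  have "(cmod (z $ 1))\<^sup>2 < 1" "(cmod (z $ 2))\<^sup>2 < 1"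
    using assms zero_le_power2[of "cmod (z $ 1)"] zero_le_power2[of "cmod (z $ 2)"]
    unfolding ball_times_bidisc_def mem_Collect_eq by linarith+
  then have "cmod (z $ 1) < 1" "cmod (z $ 2) < 1"
    by (simp_all add: abs_square_less_1)
  then show ?thesis
    using assms exhaust_4[of i] by (auto simp: ball_times_bidisc_def)
qed

lemma bounded_ball_times_bidisc: "bounded ball_times_bidisc"
  unfolding bounded_iff
proof (intro exI ballI)
  fix z assume "z \<in> ball_times_bidisc"
  have "norm z \<le> (\<Sum>i\<in>UNIV. cmod (z $ i))" by (simp add: norm_vec_def L2_set_le_sum)
  also have "\<dots> \<le> (\<Sum>i\<in>(UNIV :: 4 set). 1)"
    by (rule sum_mono, rule less_imp_le, rule nth_less_1_ball_times_bidisc[OF \<open>z \<in> _\<close>])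
  finally show "norm z \<le> 4" by simp
qed

lemma smult_ball_times_bidisc:
  assumes z: "z \<in> ball_times_bidisc" and c: "cmod c \<le> 1"
  shows "c *s z \<in> ball_times_bidisc"
proof -
  have c2: "(cmod c)\<^sup>2 \<le> 1" using c by (simp add: power_le_one)
  have "(cmod c * cmod (z $ 1))\<^sup>2 + (cmod c * cmod (z $ 2))\<^sup>2
      = (cmod c)\<^sup>2 * ((cmod (z $ 1))\<^sup>2 + (cmod (z $ 2))\<^sup>2)"
    by (simp add: power_mult_distrib algebra_simps)
  also have "\<dots> \<le> 1 * ((cmod (z $ 1))\<^sup>2 + (cmod (z $ 2))\<^sup>2)"
    using c2 by (intro mult_right_mono) auto
  finally have "(cmod c * cmod (z $ 1))\<^sup>2 + (cmod c * cmod (z $ 2))\<^sup>2 < 1"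
    using z by (simp add: ball_times_bidisc_def)
  moreover have "cmod c * cmod (z $ i) < 1" for i
    using mult_right_mono[OF c norm_ge_zero[of "z $ i"]] nth_less_1_ball_times_bidisc[OF z, of i] by linarith
  ultimately show ?thesis
    by (simp add: ball_times_bidisc_def norm_mult)
qed

text \<open>The functional is the inner product with the unit vector in the direction of (z1, z2);
  Cauchy-Schwarz bounds it on the ball. It encodes membership in the ball by a single scalar
  inequality.\<close>

lemma norming_functional:
  fixes z :: "complex ^ 4"
  obtains d where "\<And>w. w \<in> ball_times_bidisc \<Longrightarrow> cmod (lin d w) < 1"
    "(cmod (lin d z))\<^sup>2 = (cmod (z $ 1))\<^sup>2 + (cmod (z $ 2))\<^sup>2"
proof -
  define s where "s = sqrt ((cmod (z $ 1))\<^sup>2 + (cmod (z $ 2))\<^sup>2)"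
  have s2: "s\<^sup>2 = (cmod (z $ 1))\<^sup>2 + (cmod (z $ 2))\<^sup>2" by (simp add: s_def)
  \<comment> \<open>If z1 = z2 = 0 then s = 0 and division by zero yields a = b = 0: the zero
    functional, which still meets both claims.\<close>
  define a b where "a = cnj (z $ 1) / of_real s" and "b = cnj (z $ 2) / of_real s"
  define d :: "complex ^ 4" where "d = (\<chi> i. if i = 1 then a else if i = 2 then b else 0)"
  have lin: "lin d w = a * w $ 1 + b * w $ 2" for w
    by (simp add: lin_def sum_4 d_def)
  have ab: "(cmod a)\<^sup>2 + (cmod b)\<^sup>2 \<le> 1"
  proof (cases "s = 0")
    case False
    then show ?thesis
      using s2 by (simp add: a_def b_def norm_divide power_divide flip: add_divide_distrib)
  qed (simp add: a_def b_def)
  have "cmod (lin d w) < 1" if w: "w \<in> ball_times_bidisc" for w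
  proof -
    define x y u v where "x = cmod a" and "y = cmod b" and "u = cmod (w $ 1)" and "v = cmod (w $ 2)"
    have "cmod (lin d w) \<le> x * u + y * v"
      unfolding lin x_def y_def u_def v_def by (metis norm_mult norm_triangle_ineq)
    have "(x * u + y * v)\<^sup>2 \<le> (x\<^sup>2 + y\<^sup>2) * (u\<^sup>2 + v\<^sup>2)"
      using zero_le_power2[of "x * v - y * u"] by (simp add: power2_eq_square algebra_simps)
    also have "\<dots> \<le> 1 * (u\<^sup>2 + v\<^sup>2)"
      using ab by (intro mult_right_mono) (auto simp: x_def y_def)
    also have "\<dots> < 1" using w by (simp add: ball_times_bidisc_def u_def v_def)
    finally have "(x * u + y * v)\<^sup>2 < 1" .
    then have "x * u + y * v < 1" by (simp add: abs_square_less_1)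
    then show ?thesis using \<open>cmod (lin d w) \<le> x * u + y * v\<close> by linarith
  qed
  moreover have "lin d z = of_real s"
  proof (cases "s = 0")
    case False
    have "lin d z = of_real ((cmod (z $ 1))\<^sup>2 + (cmod (z $ 2))\<^sup>2) / of_real s"
      by (simp add: lin a_def b_def add_divide_distrib complex_norm_square mult.commute del: of_real_power)
    also have "\<dots> = of_real s"
      using False unfolding s2[symmetric] by (simp add: power2_eq_square)
    finally show ?thesis .
  qed (simp add: lin a_def b_def)
  then have "(cmod (lin d z))\<^sup>2 = (cmod (z $ 1))\<^sup>2 + (cmod (z $ 2))\<^sup>2"
    using s2 by simp
  ultimately show ?thesis using that by blast
qed

lemma lin_axis_less_1_ball_times_bidisc: "w \<in> ball_times_bidisc \<Longrightarrow> cmod (lin (axis i 1) w) < 1"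
  using nth_less_1_ball_times_bidisc by simp

text \<open>At a point of the hyperplane, the slice in the i-th direction meets the hyperplane only
  in that point. The puncture lemma thus bounds every functional that is below 1 on the product. The
  norming functional of the value handles the ball factor, the last two coordinates handle the
  discs.\<close>

lemma maps_ball_times_bidisc_into_itself:
  assumes F: "holo_map_on F ball_times_bidisc"
    and off: "\<And>z. z \<in> ball_times_bidisc \<Longrightarrow> z $ i \<noteq> 0 \<Longrightarrow> F z \<in> ball_times_bidisc"
    and z: "z \<in> ball_times_bidisc"
  shows "F z \<in> ball_times_bidisc"
proof (cases "z $ i = 0")
  case True
  define S where "S = {\<zeta>. upd z i \<zeta> \<in> ball_times_bidisc}"
  have "open ((\<lambda>\<zeta>. upd z i \<zeta>) -` ball_times_bidisc)"
    by (rule open_vimage[OF open_ball_times_bidisc]) (intro continuous_intros)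
  then have S: "open S" by (simp add: S_def vimage_def)
  have z0: "upd z i 0 = z" using True by (metis upd_id)
  then have S0: "0 \<in> S" using z by (simp add: S_def)
  have key: "cmod (lin d (F z)) < 1" if d: "\<And>w. w \<in> ball_times_bidisc \<Longrightarrow> cmod (lin d w) < 1" for d
  proof -
    have "(\<lambda>\<zeta>. lin d (F (upd z i \<zeta>))) holomorphic_on S"
      by (rule holo_fun_on_slice[OF holo_fun_on_lin[OF F] S]) (simp add: S_def)
    then have "cmod (lin d (F (upd z i 0))) < 1"
      by (rule cmod_less_1_at_puncture[OF _ S S0]) (use d off in \<open>auto simp: S_def\<close>)
    then show ?thesis by (simp only: z0)
  qed
  obtain d where d: "\<And>w. w \<in> ball_times_bidisc \<Longrightarrow> cmod (lin d w) < 1"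
    "(cmod (lin d (F z)))\<^sup>2 = (cmod (F z $ 1))\<^sup>2 + (cmod (F z $ 2))\<^sup>2"
    using norming_functional by blast
  have "(cmod (F z $ 1))\<^sup>2 + (cmod (F z $ 2))\<^sup>2 < 1"
    using key[OF d(1)] unfolding d(2)[symmetric] by (simp add: abs_square_less_1)
  then show ?thesis
    using key[OF lin_axis_less_1_ball_times_bidisc] by (simp add: ball_times_bidisc_def)
qed (use off z in blast)

text \<open>Summed over the sign patterns all cross terms cancel; an overall sign is irrelevant, so
  the sign of x is kept fixed and four patterns suffice.\<close>

lemma parallelogram_3:
  "(cmod (x + y + z))\<^sup>2 + (cmod (x + y - z))\<^sup>2 + (cmod (x - y + z))\<^sup>2 + (cmod (x - y - z))\<^sup>2
   = 4 * ((cmod x)\<^sup>2 + (cmod y)\<^sup>2 + (cmod z)\<^sup>2)"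
  by (simp only: cmod_power2 plus_complex.sel minus_complex.sel) (simp add: power2_eq_square algebra_simps)

lemma no_automorphism_mapping_disc_slice_to_ball_slice:
  assumes \<Phi>: "holo_map_on \<Phi> ball_times_bidisc" and \<Psi>: "holo_map_on \<Psi> ball_times_bidisc"
    and \<Phi>W: "\<And>z. z \<in> ball_times_bidisc \<Longrightarrow> \<Phi> z \<in> ball_times_bidisc"
    and \<Psi>W: "\<And>z. z \<in> ball_times_bidisc \<Longrightarrow> \<Psi> z \<in> ball_times_bidisc"
    and \<Psi>\<Phi>: "\<And>z. z \<in> ball_times_bidisc \<Longrightarrow> \<Psi> (\<Phi> z) = z"
    and \<Phi>\<Psi>: "\<And>z. z \<in> ball_times_bidisc \<Longrightarrow> \<Phi> (\<Psi> z) = z"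
    and \<Phi>0: "\<And>z. z \<in> ball_times_bidisc \<Longrightarrow> z $ 3 = 0 \<Longrightarrow> \<Phi> z $ 1 = 0"
    and \<Psi>0: "\<And>z. z \<in> ball_times_bidisc \<Longrightarrow> z $ 1 = 0 \<Longrightarrow> \<Psi> z $ 3 = 0"
  shows False
proof -
  let ?W = ball_times_bidisc
  define P :: "(complex ^ 4) set" where "P = {x. \<forall>i. cmod (x $ i) < 1}"
  have WP: "?W \<subseteq> P" using nth_less_1_ball_times_bidisc by (auto simp: P_def)
  have PW: "x \<in> ?W" if "x \<in> P" "x $ 1 = 0" for x
    using that by (simp add: P_def ball_times_bidisc_def abs_square_less_1)
  have "P = (\<Inter>i. {x. cmod (x $ i) < 1})" by (auto simp: P_def)
  moreover have "open {x :: complex ^ 4. cmod (x $ i) < 1}" for i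
    by (intro open_Collect_less continuous_intros)
  ultimately have oP: "open P" by auto
  have W0: "0 \<in> ?W" by (simp add: ball_times_bidisc_def)
  define s where "s = \<Phi> 0"
  have sW: "s \<in> ?W" using \<Phi>W[OF W0] by (simp add: s_def)
  have s1: "s $ 1 = 0" using \<Phi>0[OF W0] by (simp add: s_def)
  have sn: "cmod (s $ i) < 1" for i using nth_less_1_ball_times_bidisc[OF sW] .
  \<comment> \<open>In each coordinate \<open>M\<close> is the disc automorphism taking 0 to s_i and
    \<open>N\<close> its inverse. As s_1 = 0, the first coordinate is left alone and the slice {x_1
    = 0} is preserved.\<close>
  define M where "M x = (\<chi> i. Moebius_function 0 (- s $ i) (x $ i))" for x :: "complex ^ 4"
  define N where "N x = (\<chi> i. Moebius_function 0 (s $ i) (x $ i))" for x :: "complex ^ 4"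
  have hM: "holo_map_on M P" and hN: "holo_map_on N P"
    unfolding holo_map_on_def M_def N_def
    using sn by (auto simp: P_def intro!: holo_fun_on_compose_field[OF holo_fun_on_nth Moebius_function_holomorphic])
  have MP: "M x \<in> P" and NP: "N x \<in> P" if "x \<in> P" for x
    using that sn by (auto simp: P_def M_def N_def intro!: Moebius_function_norm_lt_1)
  have NM: "N (M x) = x" if "x \<in> P" for x
    using that sn by (auto simp: P_def M_def N_def vec_eq_iff intro!: Moebius_function_compose)
  have M0: "M 0 = s" by (simp add: M_def vec_eq_iff Moebius_function_of_zero)
  have N0: "N s = 0" by (simp add: N_def vec_eq_iff Moebius_function_eq_zero)
  have M1: "M x $ 1 = x $ 1" for x by (simp add: M_def s1 Moebius_function_simple)
  have P0: "0 \<in> P" by (simp add: P_def)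
  \<comment> \<open>\<open>M\<close> preserves the polydisc but need not preserve the product with
    the ball, so g is considered on an open neighbourhood of 0; it contains the whole slice of the
    polydisc with first coordinate 0.\<close>
  define Q where "Q = P \<inter> M -` ?W"
  have oQ: "open Q"
    unfolding Q_def by (rule continuous_open_preimage[OF holo_map_on_continuous[OF hM] oP open_ball_times_bidisc])
  have Q0: "0 \<in> Q" using P0 sW by (simp add: Q_def M0)
  define g where "g x = \<Psi> (M x)" for x
  define h where "h w = N (\<Phi> w)" for w
  have hg: "holo_map_on g Q"
    unfolding g_def[abs_def] by (rule holo_map_on_compose[OF \<Psi> holo_map_on_subset[OF hM]]) (auto simp: Q_def)
  have hh: "holo_map_on h ?W"
    unfolding h_def[abs_def] by (rule holo_map_on_compose[OF hN \<Phi>]) (use WP \<Phi>W in blast)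
  have g0: "g 0 = 0" using \<Psi>\<Phi>[OF W0] by (simp add: g_def M0 s_def)
  have h0: "h 0 = 0" using N0 by (simp add: h_def s_def)
  have hgx: "h (g x) = x" if "x \<in> Q" for x
    using that \<Phi>\<Psi>[of "M x"] NM[of x] by (simp add: g_def h_def Q_def)
  obtain g' where g': "(g has_derivative g') (at 0)" "\<And>c v. g' (c *s v) = c *s g' v"
    using holo_map_onD[OF hg Q0] by blast
  obtain h' where h': "(h has_derivative h') (at 0)" "\<And>c v. h' (c *s v) = c *s h' v"
    using holo_map_onD[OF hh W0] by blast
  have "((\<lambda>x. h (g x)) has_derivative (\<lambda>v. h' (g' v))) (at 0)"
    using has_derivative_compose[OF g'(1)] h'(1) by (simp add: g0)
  then have "((\<lambda>x. x) has_derivative (\<lambda>v. h' (g' v))) (at 0)"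
    by (rule has_derivative_transform_within_open[OF _ oQ Q0]) (rule hgx)
  then have "(\<lambda>v. h' (g' v)) = (\<lambda>v. v)"
    by (rule has_derivative_unique) (rule has_derivative_ident)
  then have hg': "h' (g' v) = v" for v by (rule fun_cong)
  have lineP: "\<zeta> *s c \<in> P" if "\<And>i. cmod (c $ i) \<le> 1" "cmod \<zeta> < 1" for \<zeta> and c :: "complex ^ 4"
  proof -
    have "cmod \<zeta> * cmod (c $ i) < 1" for i
      using mult_left_mono[OF that(1)[of i] norm_ge_zero[of \<zeta>]] that(2) by linarith
    then show ?thesis by (simp add: P_def norm_mult)
  qed
  have lineQ: "\<zeta> *s c \<in> Q" "g (\<zeta> *s c) \<in> ?W" "g (\<zeta> *s c) $ 3 = 0"
    if "\<And>i. cmod (c $ i) \<le> 1" "c $ 1 = 0" "cmod \<zeta> < 1" for \<zeta> c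
  proof -
    have P: "\<zeta> *s c \<in> P" using lineP that by blast
    have MW: "M (\<zeta> *s c) \<in> ?W"
      by (rule PW[OF MP[OF P]]) (simp add: M1 that(2))
    with P show "\<zeta> *s c \<in> Q" by (simp add: Q_def)
    show "g (\<zeta> *s c) \<in> ?W" unfolding g_def by (rule \<Psi>W[OF MW])
    show "g (\<zeta> *s c) $ 3 = 0" unfolding g_def by (rule \<Psi>0[OF MW]) (simp add: M1 that(2))
  qed
  have upper: "(cmod (g' c $ 1))\<^sup>2 + (cmod (g' c $ 2))\<^sup>2 \<le> 1" "(cmod (g' c $ 4))\<^sup>2 \<le> 1"
    if c: "\<And>i. cmod (c $ i) \<le> 1" "c $ 1 = 0" for c
  proof -
    have key: "cmod (lin d (g' c)) \<le> 1" if d: "\<And>w. w \<in> ?W \<Longrightarrow> cmod (lin d w) < 1" for d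
      by (rule Schwarz_derivative_on_line[OF hg g' g0]) (use lineQ c d in blast)+
    obtain d where d: "\<And>w. w \<in> ?W \<Longrightarrow> cmod (lin d w) < 1"
      "(cmod (lin d (g' c)))\<^sup>2 = (cmod (g' c $ 1))\<^sup>2 + (cmod (g' c $ 2))\<^sup>2"
      using norming_functional by blast
    show "(cmod (g' c $ 1))\<^sup>2 + (cmod (g' c $ 2))\<^sup>2 \<le> 1"
      unfolding d(2)[symmetric] using key[OF d(1)] by (simp add: power_le_one)
    have "cmod (lin (axis 4 1) (g' c)) \<le> 1"
      by (rule key) (rule lin_axis_less_1_ball_times_bidisc)
    then show "(cmod (g' c $ 4))\<^sup>2 \<le> 1" by (simp add: power_le_one)
  qed
  \<comment> \<open>The map g sends the slice {x_1 = 0} into {z_3 = 0}, so the third component is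
    constantly 0 along these lines.\<close>
  have third: "g' c $ 3 = 0" if c: "\<And>i. cmod (c $ i) \<le> 1" "c $ 1 = 0" for c
  proof -
    have "((\<lambda>z. lin (axis 3 1) (g z)) has_derivative (\<lambda>v. lin (axis 3 1) (g' v))) (at (0 + 0 *s c))"
      using bounded_linear.has_derivative[OF bounded_linear_lin[of "axis 3 1"] g'(1)] by simp
    then have "((\<lambda>\<zeta>. lin (axis 3 1) (g (0 + \<zeta> *s c))) has_field_derivative lin (axis 3 1) (g' c)) (at 0)"
      by (rule has_field_derivative_on_line) (simp add: g'(2))
    then have "((\<lambda>\<zeta>. 0) has_field_derivative g' c $ 3) (at (0::complex))"
      unfolding lin_axis
      by (rule has_field_derivative_transform_within_open[where S = "ball 0 1"]) (use lineQ(3) c in auto)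
    then show ?thesis by (rule DERIV_unique) (rule DERIV_const)
  qed
  \<comment> \<open>Otherwise v would lie in the open product, and so would tv for some t > 1.
    Schwarz' lemma for h on the line through tv bounds the i-th component of h'(tv) by 1, but h'
    inverts g', so that component equals t.\<close>
  have lower: "1 \<le> (cmod (g' (axis i 1) $ 1))\<^sup>2 + (cmod (g' (axis i 1) $ 2))\<^sup>2 + (cmod (g' (axis i 1) $ 4))\<^sup>2"
    if i: "i \<noteq> 1" for i :: 4
  proof (rule ccontr)
    define v where "v = g' (axis i 1)"
    assume "\<not> ?thesis"
    then have lt: "(cmod (v $ 1))\<^sup>2 + (cmod (v $ 2))\<^sup>2 + (cmod (v $ 4))\<^sup>2 < 1" by (simp add: v_def)
    have v3: "v $ 3 = 0" unfolding v_def by (rule third) (use i in \<open>auto simp: axis_def\<close>)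
    have a: "(cmod (v $ 1))\<^sup>2 + (cmod (v $ 2))\<^sup>2 < 1" and b: "(cmod (v $ 4))\<^sup>2 < 1"
      using lt zero_le_power2[of "cmod (v $ 4)"] zero_le_power2[of "cmod (v $ 1)"] zero_le_power2[of "cmod (v $ 2)"]
      by linarith+
    have vW: "v \<in> ?W"
      using a b v3 by (simp add: ball_times_bidisc_def abs_square_less_1)
    have "((\<lambda>t. of_real t *s v) \<longlongrightarrow> of_real 1 *s v) (at_right (1::real))"
      unfolding vector_scalar_mult_def by (intro tendsto_intros)
    then have "\<forall>\<^sub>F t in at_right (1::real). of_real t *s v \<in> ?W"
      by (rule topological_tendstoD[OF _ open_ball_times_bidisc]) (simp add: vW)
    then obtain t :: real where t: "t > 1" "of_real t *s v \<in> ?W"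
      using eventually_at_right_less[of 1] eventually_happens'[OF trivial_limit_at_right_real]
      by (metis (mono_tags, lifting) eventually_conj)
    have lW: "\<zeta> *s (of_real t *s v) \<in> ?W" if "cmod \<zeta> < 1" for \<zeta>
      using smult_ball_times_bidisc[OF t(2)] that by simp
    have "cmod (lin (axis i 1) (h' (of_real t *s v))) \<le> 1"
    proof (rule Schwarz_derivative_on_line[OF hh h' h0])
      fix \<zeta> :: complex assume z: "cmod \<zeta> < 1"
      show "\<zeta> *s (of_real t *s v) \<in> ?W" by (rule lW[OF z])
      have "h (\<zeta> *s (of_real t *s v)) \<in> P"
        unfolding h_def using NP \<Phi>W[OF lW[OF z]] WP by blast
      then show "cmod (lin (axis i 1) (h (\<zeta> *s (of_real t *s v)))) < 1"
        by (simp add: P_def)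
    qed
    moreover have "h' (of_real t *s v) $ i = of_real t"
      unfolding h'(2) v_def hg' by (simp add: axis_def)
    ultimately show False using t(1) by simp
  qed
  define x where "x i = g' (axis i 1)" for i
  \<comment> \<open>For \<epsilon> and \<delta> equal to 1 or -1 these are points (0, 1, \<epsilon>,
    \<delta>) of the closed polydisc, to which \<open>upper\<close> applies.\<close>
  define c where "c \<epsilon> \<delta> = (axis 2 1 + \<epsilon> *s axis 3 1 + \<delta> *s axis 4 1 :: complex ^ 4)" for \<epsilon> \<delta>
  have g'c: "g' (c \<epsilon> \<delta>) = x 2 + \<epsilon> *s x 3 + \<delta> *s x 4" for \<epsilon> \<delta>
    using has_derivative_linear[OF g'(1)] by (simp add: c_def x_def linear_add g'(2))
  have c: "cmod (c \<epsilon> \<delta> $ i) \<le> 1" "c \<epsilon> \<delta> $ 1 = 0" if "cmod \<epsilon> \<le> 1" "cmod \<delta> \<le> 1" for \<epsilon> \<delta> i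
    using that exhaust_4[of i] by (auto simp: c_def axis_def)
  have A: "(cmod (x 2 $ l + x 3 $ l + x 4 $ l))\<^sup>2 + (cmod (x 2 $ l + x 3 $ l - x 4 $ l))\<^sup>2
      + (cmod (x 2 $ l - x 3 $ l + x 4 $ l))\<^sup>2 + (cmod (x 2 $ l - x 3 $ l - x 4 $ l))\<^sup>2
      = 4 * ((cmod (x 2 $ l))\<^sup>2 + (cmod (x 3 $ l))\<^sup>2 + (cmod (x 4 $ l))\<^sup>2)" for l
    by (rule parallelogram_3)
  have "(cmod (x 2 $ 1 + \<epsilon> * x 3 $ 1 + \<delta> * x 4 $ 1))\<^sup>2 + (cmod (x 2 $ 2 + \<epsilon> * x 3 $ 2 + \<delta> * x 4 $ 2))\<^sup>2 \<le> 1"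
       "(cmod (x 2 $ 4 + \<epsilon> * x 3 $ 4 + \<delta> * x 4 $ 4))\<^sup>2 \<le> 1" if "cmod \<epsilon> \<le> 1" "cmod \<delta> \<le> 1" for \<epsilon> \<delta>
    using upper[of "c \<epsilon> \<delta>"] c[OF that] by (simp_all add: g'c)
  note U = this[of 1 1] this[of 1 "-1"] this[of "-1" 1] this[of "-1" "-1"]
  have "1 \<le> (cmod (x i $ 1))\<^sup>2 + (cmod (x i $ 2))\<^sup>2 + (cmod (x i $ 4))\<^sup>2" if "i \<noteq> 1" for i
    unfolding x_def by (rule lower[OF that])
  \<comment> \<open>Adding the upper bounds over four sign patterns gives at most 4 + 4 = 8. By the
    parallelogram identity in the components 1, 2 and 4 the same sum is 4 times a sum of three
    terms, each at least 1, hence at least 12.\<close>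
  from this[of 2] this[of 3] this[of 4] U A[of 1] A[of 2] A[of 4]
  show False by simp
qed

section \<open>The two domains\<close>

lemma biholomorphic_sym: "biholomorphic D E \<Longrightarrow> biholomorphic E D"
  unfolding biholomorphic_def by blast

lemma biholomorphic_trans:
  assumes "biholomorphic D E" "biholomorphic E H"
  shows "biholomorphic D H"
proof -
  obtain F G where F: "holo_map_on F D" "holo_map_on G E" "F ` D \<subseteq> E" "G ` E \<subseteq> D"
    "\<And>z. z \<in> D \<Longrightarrow> G (F z) = z" "\<And>w. w \<in> E \<Longrightarrow> F (G w) = w"
    using assms(1) unfolding biholomorphic_def by blast
  obtain F' G' where F': "holo_map_on F' E" "holo_map_on G' H" "F' ` E \<subseteq> H" "G' ` H \<subseteq> E"
    "\<And>z. z \<in> E \<Longrightarrow> G' (F' z) = z" "\<And>w. w \<in> H \<Longrightarrow> F' (G' w) = w"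
    using assms(2) unfolding biholomorphic_def by blast
  have FD: "F z \<in> E" if "z \<in> D" for z using F(3) that by blast
  have G'H: "G' w \<in> E" if "w \<in> H" for w using F'(4) that by blast
  show ?thesis
    unfolding biholomorphic_def
  proof (intro exI conjI)
    show "holo_map_on (\<lambda>z. F' (F z)) D" by (rule holo_map_on_compose[OF F'(1) F(1) FD])
    show "holo_map_on (\<lambda>w. G (G' w)) H" by (rule holo_map_on_compose[OF F(2) F'(2) G'H])
    show "(\<lambda>z. F' (F z)) ` D \<subseteq> H" using F(3) F'(3) by blast
    show "(\<lambda>w. G (G' w)) ` H \<subseteq> D" using F(4) F'(4) by blast
    show "\<forall>z\<in>D. G (G' (F' (F z))) = z" using F(5) F'(5) FD by simp
    show "\<forall>w\<in>H. F' (F (G (G' w))) = w" using F(6) F'(6) G'H by simp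
  qed
qed

lemma shear_biholomorphic:
  assumes ij: "i \<noteq> j"
  shows "biholomorphic (W \<inter> {z :: complex ^ 'n. z $ i \<noteq> 0}) {w. w $ i \<noteq> 0 \<and> upd w j (w $ j / w $ i ^ k) \<in> W}"
  unfolding biholomorphic_def
proof (intro exI conjI)
  show "holo_map_on (\<lambda>z. upd z j (z $ i ^ k * z $ j)) (W \<inter> {z. z $ i \<noteq> 0})"
    by (intro holo_map_on_upd holo_fun_on_mult holo_fun_on_nth holo_fun_on_power)
  show "holo_map_on (\<lambda>w. upd w j (w $ j / w $ i ^ k)) {w. w $ i \<noteq> 0 \<and> upd w j (w $ j / w $ i ^ k) \<in> W}"
    by (intro holo_map_on_upd holo_fun_on_divide holo_fun_on_nth holo_fun_on_power) simp
qed (use ij in auto)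

text \<open>Riemann's extension theorem as a case of the L^p one: on a bounded set a bounded
  function has finite p-th power mass for every p, and 3 is a choice above 2.\<close>

lemma bounded_holo_map_extends_across_hyperplane:
  fixes F :: "complex ^ 'n \<Rightarrow> complex ^ 'm"
  assumes U: "open U" "bounded U" and F: "holo_map_on F (U \<inter> {z. z $ i \<noteq> 0})"
    and bdd: "bounded (F ` (U \<inter> {z. z $ i \<noteq> 0}))"
  obtains G where "holo_map_on G U" "\<And>z. z \<in> U \<Longrightarrow> z $ i \<noteq> 0 \<Longrightarrow> G z = F z"
proof -
  let ?V = "U \<inter> {z. z $ i \<noteq> 0}"
  obtain C where C: "\<And>z. z \<in> ?V \<Longrightarrow> norm (F z) \<le> C"
    using bdd by (auto simp: bounded_iff)
  have "\<exists>G. holo_fun_on G U \<and> (\<forall>z\<in>U. z $ i \<noteq> 0 \<longrightarrow> G z = F z $ l)" for l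
  proof -
    have hl: "holo_fun_on (\<lambda>z. F z $ l) ?V" using F by (simp add: holo_map_on_def)
    have "(\<integral>\<^sup>+z. indicator ?V z * ennreal (cmod (F z $ l) powr 3) \<partial>lborel)
        \<le> (\<integral>\<^sup>+z. ennreal (C powr 3) * indicator U z \<partial>lborel)"
    proof (rule nn_integral_mono)
      fix z
      show "indicator ?V z * ennreal (cmod (F z $ l) powr 3) \<le> ennreal (C powr 3) * indicator U z"
      proof (cases "z \<in> ?V")
        case True
        have "cmod (F z $ l) \<le> C"
          using C[OF True] Finite_Cartesian_Product.norm_nth_le[of "F z" l] by linarith
        then have "ennreal (cmod (F z $ l) powr 3) \<le> ennreal (C powr 3)"
          by (intro ennreal_leI powr_mono2) auto
        then show ?thesis using True by simp
      next
        case False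
        then have "indicator ?V z = (0::ennreal)" by (rule indicator_simps(2))
        then show ?thesis by simp
      qed
    qed
    also have "\<dots> = ennreal (C powr 3) * emeasure lborel U"
      using U(1) by (simp add: nn_integral_cmult_indicator)
    also have "\<dots> < \<infinity>"
      using emeasure_bounded_finite[OF U(2)] by (simp add: ennreal_mult_less_top)
    finally have fin: "(\<integral>\<^sup>+z. indicator ?V z * ennreal (cmod (F z $ l) powr 3) \<partial>lborel) < \<infinity>" .
    have "(2::real) < 3" by simp
    show ?thesis
    proof (rule Lp_extends_across_hyperplane[OF U(1) hl \<open>2 < 3\<close> fin])
      fix G assume G: "holo_fun_on G U" "\<And>z. z \<in> U \<Longrightarrow> z $ i \<noteq> 0 \<Longrightarrow> G z = F z $ l"
      show ?thesis by (intro exI[of _ G] conjI ballI impI G)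
    qed
  qed
  then obtain G where G: "\<And>l. holo_fun_on (G l) U" "\<And>l z. z \<in> U \<Longrightarrow> z $ i \<noteq> 0 \<Longrightarrow> G l z = F z $ l"
    by metis
  show ?thesis
  proof (rule that[of "\<lambda>z. \<chi> l. G l z"])
    show "holo_map_on (\<lambda>z. \<chi> l. G l z) U" using G(1) by (simp add: holo_map_on_def)
  qed (simp add: vec_eq_iff G(2))
qed

lemma holo_map_on_eq_if_eq_off_hyperplane:
  fixes F G :: "complex ^ 'n \<Rightarrow> complex ^ 'm"
  assumes U: "open U" and F: "continuous_on U F" and G: "continuous_on U G"
    and eq: "\<And>z. z \<in> U \<Longrightarrow> z $ i \<noteq> 0 \<Longrightarrow> F z = G z" and z: "z \<in> U"
  shows "F z = G z"
proof (rule continuous_AE_eq_imp_eq[OF U F G _ z])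
  show "AE z in lborel. z \<in> U \<longrightarrow> F z = G z"
    using AE_coordinate_nonzero[of i] by eventually_elim (use eq in auto)
qed

lemma not_biholomorphic_punctured:
  "\<not> biholomorphic (ball_times_bidisc \<inter> {z. z $ 3 \<noteq> 0}) (ball_times_bidisc \<inter> {z. z $ 1 \<noteq> 0})"
proof
  let ?W = ball_times_bidisc
  let ?X = "?W \<inter> {z. z $ 3 \<noteq> 0}" and ?Y = "?W \<inter> {z. z $ 1 \<noteq> 0}"
  assume "biholomorphic ?X ?Y"
  then obtain F G where F: "holo_map_on F ?X" "F ` ?X \<subseteq> ?Y" and G: "holo_map_on G ?Y" "G ` ?Y \<subseteq> ?X"
    and GF: "\<And>z. z \<in> ?X \<Longrightarrow> G (F z) = z" and FG: "\<And>w. w \<in> ?Y \<Longrightarrow> F (G w) = w"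
    unfolding biholomorphic_def by blast
  have "bounded (F ` ?X)" "bounded (G ` ?Y)"
    using F(2) G(2) bounded_subset[OF bounded_ball_times_bidisc] by blast+
  then obtain \<Phi> \<Psi> where \<Phi>: "holo_map_on \<Phi> ?W" "\<And>z. z \<in> ?W \<Longrightarrow> z $ 3 \<noteq> 0 \<Longrightarrow> \<Phi> z = F z"
    and \<Psi>: "holo_map_on \<Psi> ?W" "\<And>z. z \<in> ?W \<Longrightarrow> z $ 1 \<noteq> 0 \<Longrightarrow> \<Psi> z = G z"
    using bounded_holo_map_extends_across_hyperplane[OF open_ball_times_bidisc bounded_ball_times_bidisc F(1)]
      bounded_holo_map_extends_across_hyperplane[OF open_ball_times_bidisc bounded_ball_times_bidisc G(1)]
    by metis
  have \<Phi>X: "\<Phi> z \<in> ?Y" if "z \<in> ?X" for z using that \<Phi>(2) F(2) by auto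
  have \<Psi>Y: "\<Psi> z \<in> ?X" if "z \<in> ?Y" for z using that \<Psi>(2) G(2) by auto
  have \<Phi>W: "\<Phi> z \<in> ?W" if "z \<in> ?W" for z
    by (rule maps_ball_times_bidisc_into_itself[OF \<Phi>(1) _ that, of 3]) (use \<Phi>X in blast)
  have \<Psi>W: "\<Psi> z \<in> ?W" if "z \<in> ?W" for z
    by (rule maps_ball_times_bidisc_into_itself[OF \<Psi>(1) _ that, of 1]) (use \<Psi>Y in blast)
  have \<Psi>\<Phi>X: "\<Psi> (\<Phi> z) = z" if "z \<in> ?X" for z
    using \<Phi>X[OF that] \<Psi>(2)[of "\<Phi> z"] \<Phi>(2)[of z] GF[OF that] that by auto
  have \<Phi>\<Psi>Y: "\<Phi> (\<Psi> z) = z" if "z \<in> ?Y" for z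
    using \<Psi>Y[OF that] \<Phi>(2)[of "\<Psi> z"] \<Psi>(2)[of z] FG[OF that] that by auto
  have \<Psi>\<Phi>: "\<Psi> (\<Phi> z) = z" if "z \<in> ?W" for z
    by (rule holo_map_on_eq_if_eq_off_hyperplane[OF open_ball_times_bidisc
          holo_map_on_continuous[OF holo_map_on_compose[OF \<Psi>(1) \<Phi>(1) \<Phi>W]] continuous_on_id _ that, of 3])
       (use \<Psi>\<Phi>X in auto)
  have \<Phi>\<Psi>: "\<Phi> (\<Psi> z) = z" if "z \<in> ?W" for z
    by (rule holo_map_on_eq_if_eq_off_hyperplane[OF open_ball_times_bidisc
          holo_map_on_continuous[OF holo_map_on_compose[OF \<Phi>(1) \<Psi>(1) \<Psi>W]] continuous_on_id _ that, of 1])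
       (use \<Phi>\<Psi>Y in auto)
  show False
  proof (rule no_automorphism_mapping_disc_slice_to_ball_slice[OF \<Phi>(1) \<Psi>(1) \<Phi>W \<Psi>W \<Psi>\<Phi> \<Phi>\<Psi>])
    \<comment> \<open>A point of the removed slice sent off {z_1 = 0} would come back under the
      inverse to a point with nonzero third coordinate, yet it comes back to itself.\<close>
    show "\<Phi> z $ 1 = 0" if "z \<in> ?W" "z $ 3 = 0" for z
    proof (rule ccontr)
      assume "\<Phi> z $ 1 \<noteq> 0"
      then have "\<Psi> (\<Phi> z) \<in> ?X" using \<Psi>Y \<Phi>W[OF that(1)] by blast
      then show False using \<Psi>\<Phi> that by simp
    qed
    show "\<Psi> z $ 3 = 0" if "z \<in> ?W" "z $ 1 = 0" for z
    proof (rule ccontr)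
      assume "\<Psi> z $ 3 \<noteq> 0"
      then have "\<Phi> (\<Psi> z) \<in> ?Y" using \<Phi>X \<Psi>W[OF that(1)] by blast
      then show False using \<Phi>\<Psi> that by simp
    qed
  qed
qed

section \<open>Coordinate description, connectedness and boundedness of the two domains\<close>

lemma vector2_in_unit_ball2:
  "(vector [a, b] :: complex ^ 2) \<in> unit_ball2 \<longleftrightarrow> (cmod a)\<^sup>2 + (cmod b)\<^sup>2 < 1"
  by (simp add: norm_vec_def L2_set_def sum_2)

lemma vector2_in_fmap_image:
  "(vector [a, b] :: complex ^ 2) \<in> fmap k ` A \<longleftrightarrow> (\<exists>y. vector [a, y] \<in> A \<and> b = a ^ k * y)"
proof
  assume "\<exists>y. vector [a, y] \<in> A \<and> b = a ^ k * y"
  then obtain y where "vector [a, y] \<in> A" "b = a ^ k * y" by blast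
  then show "vector [a, b] \<in> fmap k ` A"
    by (intro image_eqI[of _ _ "vector [a, y]"]) (simp_all add: fmap_def)
next
  assume "vector [a, b] \<in> fmap k ` A"
  then obtain z where z: "z \<in> A" "vector [a, b] = fmap k z" by blast
  then have "a = z $ 1" "b = z $ 1 ^ k * z $ 2"
    by (auto simp: fmap_def vec_eq_iff forall_2)
  moreover have "vector [z $ 1, z $ 2] = z" by (simp add: vec_eq_iff forall_2)
  ultimately show "\<exists>y. vector [a, y] \<in> A \<and> b = a ^ k * y" using z(1) by (intro exI[of _ "z $ 2"]) simp
qed

text \<open>Puts the domain into the form of the shear lemmas with (i, j) = (3, 4); for the other
  domain the pair is (1, 2), over the same product of ball and bidisc.\<close>

lemma D1_eq_shear: "D1 k = {w. w $ 3 \<noteq> 0 \<and> upd w 4 (w $ 4 / w $ 3 ^ k) \<in> ball_times_bidisc}"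
proof -
  have "w \<in> D1 k \<longleftrightarrow> w $ 3 \<noteq> 0 \<and> upd w 4 (w $ 4 / w $ 3 ^ k) \<in> ball_times_bidisc" for w
  proof -
    have "w \<in> D1 k \<longleftrightarrow> (cmod (w $ 1))\<^sup>2 + (cmod (w $ 2))\<^sup>2 < 1 \<and> cmod (w $ 3) < 1 \<and> w $ 3 \<noteq> 0
        \<and> (\<exists>y. cmod y < 1 \<and> w $ 4 = w $ 3 ^ k * y)"
      unfolding D1_def times4_def mem_Collect_eq vector2_in_unit_ball2 vector2_in_fmap_image
      by (auto simp: times2_def)
    also have "\<dots> \<longleftrightarrow> w $ 3 \<noteq> 0 \<and> upd w 4 (w $ 4 / w $ 3 ^ k) \<in> ball_times_bidisc"
    proof (cases "w $ 3 = 0")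
      case False
      then have "(\<exists>y. cmod y < 1 \<and> w $ 4 = w $ 3 ^ k * y) \<longleftrightarrow> cmod (w $ 4 / w $ 3 ^ k) < 1"
        by (auto intro!: exI[of _ "w $ 4 / w $ 3 ^ k"])
      with False show ?thesis by (simp add: ball_times_bidisc_def)
    qed simp
    finally show ?thesis .
  qed
  then show ?thesis by blast
qed

lemma D2_eq_shear: "D2 k = {w. w $ 1 \<noteq> 0 \<and> upd w 2 (w $ 2 / w $ 1 ^ k) \<in> ball_times_bidisc}"
proof -
  have "w \<in> D2 k \<longleftrightarrow> w $ 1 \<noteq> 0 \<and> upd w 2 (w $ 2 / w $ 1 ^ k) \<in> ball_times_bidisc" for w
  proof -
    have "w \<in> D2 k \<longleftrightarrow> (\<exists>y. (cmod (w $ 1))\<^sup>2 + (cmod y)\<^sup>2 < 1 \<and> w $ 1 \<noteq> 0 \<and> w $ 2 = w $ 1 ^ k * y)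
        \<and> cmod (w $ 3) < 1 \<and> cmod (w $ 4) < 1"
      unfolding D2_def times4_def mem_Collect_eq vector2_in_fmap_image Diff_iff vector2_in_unit_ball2
      by (auto simp: times2_def)
    also have "\<dots> \<longleftrightarrow> w $ 1 \<noteq> 0 \<and> upd w 2 (w $ 2 / w $ 1 ^ k) \<in> ball_times_bidisc"
    proof (cases "w $ 1 = 0")
      case False
      then have "(\<exists>y. (cmod (w $ 1))\<^sup>2 + (cmod y)\<^sup>2 < 1 \<and> w $ 1 \<noteq> 0 \<and> w $ 2 = w $ 1 ^ k * y)
          \<longleftrightarrow> (cmod (w $ 1))\<^sup>2 + (cmod (w $ 2 / w $ 1 ^ k))\<^sup>2 < 1"
        by (auto intro!: exI[of _ "w $ 2 / w $ 1 ^ k"])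
      with False show ?thesis by (simp add: ball_times_bidisc_def)
    qed simp
    finally show ?thesis .
  qed
  then show ?thesis by blast
qed

text \<open>\<open>(a, b) \<mapsto> (a, sqrt (1 - |a|\<^sup>2) b)\<close> maps the bidisc onto the ball and preserves the first coordinate.\<close>

lemma connected_punctured_ball_times_bidisc:
  assumes i: "i = 1 \<or> i = 3"
  shows "connected (ball_times_bidisc \<inter> {z. z $ i \<noteq> 0})"
proof -
  define A where "A l = (if l = i then ball 0 1 - {0} else ball (0::complex) 1)" for l :: 4
  have conn: "connected (A l)" for l
    using connected_punctured_ball[of "0::complex" 1] by (auto simp: A_def)
  define f :: "complex \<times> complex \<times> complex \<times> complex \<Rightarrow> complex ^ 4"
    where "f = (\<lambda>(a, b, c, d). \<chi> l. if l = 1 then a else if l = 2 then of_real (sqrt (1 - (cmod a)\<^sup>2)) * b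
      else if l = 3 then c else d)"
  have "continuous_on (A 1 \<times> A 2 \<times> A 3 \<times> A 4) f"
    unfolding f_def case_prod_beta
  proof (rule continuous_on_vec_lambda)
    show "continuous_on (A 1 \<times> A 2 \<times> A 3 \<times> A 4) (\<lambda>x. if l = 1 then fst x
       else if l = 2 then of_real (sqrt (1 - (cmod (fst x))\<^sup>2)) * fst (snd x)
       else if l = 3 then fst (snd (snd x)) else snd (snd (snd x)))" for l
      by (cases "l = 1"; cases "l = 2"; cases "l = 3") (auto intro!: continuous_intros)
  qed
  then have "connected (f ` (A 1 \<times> A 2 \<times> A 3 \<times> A 4))"
    by (intro connected_continuous_image connected_Times conn)
  moreover have "f ` (A 1 \<times> A 2 \<times> A 3 \<times> A 4) = ball_times_bidisc \<inter> {z. z $ i \<noteq> 0}"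
  proof (rule set_eqI, rule iffI)
    fix z assume "z \<in> f ` (A 1 \<times> A 2 \<times> A 3 \<times> A 4)"
    then obtain a b c d where z: "z = f (a, b, c, d)" and A: "a \<in> A 1" "b \<in> A 2" "c \<in> A 3" "d \<in> A 4"
      by auto
    have n: "cmod a < 1" "cmod b < 1" "cmod c < 1" "cmod d < 1"
      using A by (auto simp: A_def split: if_splits)
    have a2: "(cmod a)\<^sup>2 < 1" and b2: "(cmod b)\<^sup>2 < 1" using n by (simp_all add: abs_square_less_1)
    have "(1 - (cmod a)\<^sup>2) * (cmod b)\<^sup>2 < (1 - (cmod a)\<^sup>2) * 1"
      using a2 b2 by (intro mult_strict_left_mono) auto
    then have "(cmod a)\<^sup>2 + (1 - (cmod a)\<^sup>2) * (cmod b)\<^sup>2 < 1"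
      unfolding mult_1_right less_diff_eq by (simp only: add.commute)
    then have "(cmod (z $ 1))\<^sup>2 + (cmod (z $ 2))\<^sup>2 < 1"
      using a2 by (simp add: z f_def norm_mult power_mult_distrib)
    moreover have "z $ i \<noteq> 0"
      using i A by (auto simp: z f_def A_def)
    ultimately show "z \<in> ball_times_bidisc \<inter> {z. z $ i \<noteq> 0}"
      using n by (simp add: ball_times_bidisc_def z f_def)
  next
    fix z assume z: "z \<in> ball_times_bidisc \<inter> {z. z $ i \<noteq> 0}"
    define r where "r = sqrt (1 - (cmod (z $ 1))\<^sup>2)"
    have lt: "(cmod (z $ 2))\<^sup>2 < 1 - (cmod (z $ 1))\<^sup>2" using z by (simp add: ball_times_bidisc_def)
    then have "(cmod (z $ 1))\<^sup>2 < 1" using zero_le_power2[of "cmod (z $ 2)"] by linarith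
    then have r2: "r\<^sup>2 = 1 - (cmod (z $ 1))\<^sup>2" and r0: "r > 0"
      unfolding r_def by simp_all
    have "cmod (z $ 2) < r"
      using lt r2 r0 by (metis less_imp_le norm_ge_zero power_less_imp_less_base)
    then have "cmod (z $ 2 / of_real r) < 1" using r0 by (simp add: norm_divide)
    moreover have "z = f (z $ 1, z $ 2 / of_real r, z $ 3, z $ 4)"
      using r0 by (simp add: f_def vec_eq_iff forall_4 flip: r_def)
    moreover have "cmod (z $ l) < 1" for l using z nth_less_1_ball_times_bidisc by blast
    ultimately show "z \<in> f ` (A 1 \<times> A 2 \<times> A 3 \<times> A 4)"
      using z i by (intro image_eqI[of _ f "(z $ 1, z $ 2 / of_real r, z $ 3, z $ 4)"]) (auto simp: A_def)
  qed
  ultimately show ?thesis by simp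
qed

text \<open>Connectedness and boundedness are read off from the set as the image of the punctured
  product under the shear, openness from it as a preimage under the inverse shear.\<close>

lemma bounded_domain_shear:
  assumes ij: "(i, j) = (3, 4) \<or> (i, j) = (1, 2)"
  shows "bounded_domain_Cn {w :: complex ^ 4. w $ i \<noteq> 0 \<and> upd w j (w $ j / w $ i ^ k) \<in> ball_times_bidisc}"
    (is "bounded_domain_Cn ?D")
proof -
  have ne: "i \<noteq> j" and i: "i = 1 \<or> i = 3" using ij by auto
  let ?X = "ball_times_bidisc \<inter> {z. z $ i \<noteq> 0}"
  let ?S = "\<lambda>z :: complex ^ 4. upd z j (z $ i ^ k * z $ j)"
  have im: "?D = ?S ` ?X"
  proof (rule set_eqI, rule iffI)
    fix w assume w: "w \<in> ?D"
    then have "w = ?S (upd w j (w $ j / w $ i ^ k))" using ne by (simp add: vec_eq_iff)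
    then show "w \<in> ?S ` ?X" by (rule image_eqI) (use w ne in auto)
  qed (use ne in auto)
  have "connected ?D"
    unfolding im by (intro connected_continuous_image connected_punctured_ball_times_bidisc i continuous_intros)
  moreover have "open ?D"
  proof -
    have "holo_map_on (\<lambda>w. upd w j (w $ j / w $ i ^ k)) {w. w $ i \<noteq> 0}"
      by (intro holo_map_on_upd holo_fun_on_divide holo_fun_on_nth holo_fun_on_power) simp
    from continuous_open_preimage[OF holo_map_on_continuous[OF this] open_coordinate_nonzero open_ball_times_bidisc]
    show ?thesis by (simp add: vimage_def Int_def)
  qed
  moreover have "(\<chi> l. if l = i then 1 / 2 else 0) \<in> ?X"
    using i by (auto simp: ball_times_bidisc_def power2_eq_square)
  then have "?D \<noteq> {}" unfolding im by blast
  moreover have "bounded ?D"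
    unfolding bounded_iff
  proof (intro exI ballI)
    fix w assume "w \<in> ?D"
    then obtain z where z: "z \<in> ball_times_bidisc" and w: "w = ?S z" unfolding im by blast
    have "cmod (z $ i ^ k * z $ j) \<le> 1 * 1"
      unfolding norm_mult norm_power
      by (intro mult_mono power_le_one) (use nth_less_1_ball_times_bidisc[OF z] in \<open>auto intro: less_imp_le\<close>)
    then have le: "cmod (w $ l) \<le> 1" for l
      using nth_less_1_ball_times_bidisc[OF z, of l] by (auto simp: w)
    have "norm w \<le> (\<Sum>l\<in>UNIV. cmod (w $ l))" by (simp add: norm_vec_def L2_set_le_sum)
    also have "\<dots> \<le> (\<Sum>l\<in>(UNIV :: 4 set). 1)" by (rule sum_mono) (rule le)
    finally show "norm w \<le> 4" by simp
  qed
  ultimately show ?thesis by (simp add: bounded_domain_Cn_def domain_Cn_def)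
qed

section \<open>The two domains as interiors of their closures\<close>

text \<open>A point of C outside D can leave C by an arbitrarily small increase in the modulus of
  one coordinate, so it is not interior to C, still less to the closure of D. The set C need not be
  known to equal that closure.\<close>

lemma interior_closure_eqI:
  fixes D C :: "(complex ^ 'n) set"
  assumes D: "open D" and C: "closed C" "D \<subseteq> C"
    and push: "\<And>z. z \<in> C \<Longrightarrow> z \<notin> D \<Longrightarrow> \<exists>j. \<forall>\<zeta>. cmod (z $ j) < cmod \<zeta> \<longrightarrow> upd z j \<zeta> \<notin> C"
  shows "interior (closure D) = D"
proof
  show "D \<subseteq> interior (closure D)" using D closure_subset by (rule interior_maximal[rotated])
  show "interior (closure D) \<subseteq> D"
  proof
    fix z assume z: "z \<in> interior (closure D)"
    have sub: "closure D \<subseteq> C" using C by (intro closure_minimal) auto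
    show "z \<in> D"
    proof (rule ccontr)
      assume "z \<notin> D"
      moreover have "z \<in> C" using z interior_subset sub by blast
      ultimately obtain j where j: "\<And>\<zeta>. cmod (z $ j) < cmod \<zeta> \<Longrightarrow> upd z j \<zeta> \<notin> C"
        using push by blast
      obtain e where e: "e > 0" "ball z e \<subseteq> interior (closure D)"
        using z open_interior open_contains_ball by blast
      \<comment> \<open>The radial direction of z_j, or any unit number when z_j = 0; a step of
        length e/2 along it increases the modulus by exactly e/2.\<close>
      define u where "u = (if z $ j = 0 then 1 else sgn (z $ j))"
      have u: "cmod u = 1" by (simp add: u_def norm_sgn)
      have zu: "z $ j = of_real (cmod (z $ j)) * u"
        by (simp add: u_def sgn_eq)
      define \<zeta> where "\<zeta> = z $ j + of_real (e / 2) * u"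
      have "\<zeta> = of_real (cmod (z $ j) + e / 2) * u"
        unfolding \<zeta>_def by (subst zu) (simp add: algebra_simps)
      then have "cmod \<zeta> = \<bar>cmod (z $ j) + e / 2\<bar>" by (simp only: norm_mult norm_of_real u mult_1_right)
      then have "cmod (z $ j) < cmod \<zeta>" using e(1) by simp
      then have "upd z j \<zeta> \<notin> C" by (rule j)
      moreover have "upd z j \<zeta> \<in> ball z e"
        using e(1) u by (simp add: upd_eq_add dist_norm norm_axis_complex \<zeta>_def norm_mult)
      ultimately show False using e(2) interior_subset sub by blast
    qed
  qed
qed

text \<open>The last two coordinates range over the generalised Hartogs triangle |w4| < |w3|^k, |w3|
  < 1. A point violating a strict inequality is pushed out in the coordinate 1, 3 or 4 that stands
  on the left of it.\<close>

lemma interior_closure_D1: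
  assumes k: "k \<ge> 1" and D: "open (D1 k)"
  shows "interior (closure (D1 k)) = D1 k"
proof (rule interior_closure_eqI[OF D])
  define C :: "(complex ^ 4) set" where "C = {w. (cmod (w $ 1))\<^sup>2 + (cmod (w $ 2))\<^sup>2 \<le> 1
    \<and> cmod (w $ 3) \<le> 1 \<and> cmod (w $ 4) \<le> cmod (w $ 3) ^ k}"
  have D1: "w \<in> D1 k \<longleftrightarrow> (cmod (w $ 1))\<^sup>2 + (cmod (w $ 2))\<^sup>2 < 1 \<and> cmod (w $ 3) < 1
      \<and> cmod (w $ 4) < cmod (w $ 3) ^ k" for w
  proof (cases "w $ 3 = 0")
    case True
    \<comment> \<open>For k \<ge> 1 the right-hand side vanishes at w3 = 0, so the strict inequality
      excludes that hyperplane by itself.\<close>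
    then have 0: "cmod (w $ 3) ^ k = 0" using k by simp
    show ?thesis unfolding 0 using True by (simp add: D1_eq_shear)
  qed (auto simp: D1_eq_shear ball_times_bidisc_def norm_divide norm_power divide_simps)
  show "closed C" unfolding C_def
    by (intro closed_Collect_conj closed_Collect_le continuous_intros)
  show "D1 k \<subseteq> C" by (auto simp: D1 C_def)
  show "\<exists>j. \<forall>\<zeta>. cmod (z $ j) < cmod \<zeta> \<longrightarrow> upd z j \<zeta> \<notin> C" if z: "z \<in> C" "z \<notin> D1 k" for z
  proof -
    consider "(cmod (z $ 1))\<^sup>2 + (cmod (z $ 2))\<^sup>2 \<ge> 1" | "cmod (z $ 3) \<ge> 1" | "cmod (z $ 4) \<ge> cmod (z $ 3) ^ k"
      using z(2) unfolding D1 by linarith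
    then show ?thesis
    proof cases
      case 1
      have "upd z 1 \<zeta> \<notin> C" if "cmod (z $ 1) < cmod \<zeta>" for \<zeta>
      proof -
        have "(cmod (z $ 1))\<^sup>2 < (cmod \<zeta>)\<^sup>2" using that by (intro power_strict_mono) auto
        then show ?thesis using 1 by (simp add: C_def)
      qed
      then show ?thesis by blast
    next
      case 2
      then show ?thesis by (intro exI[of _ 3]) (auto simp: C_def)
    next
      case 3
      then show ?thesis by (intro exI[of _ 4]) (auto simp: C_def)
    qed
  qed
qed

lemma interior_closure_D2:
  assumes k: "k \<ge> 1" and D: "open (D2 k)"
  shows "interior (closure (D2 k)) = D2 k"
proof (rule interior_closure_eqI[OF D])
  \<comment> \<open>Clearing denominators in |w1|^2 + |w2/w1^k|^2 < 1 turns it into |w2|^2 <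
    \<rho>(w). As \<rho> depends on w1 only, enlarging |w2| breaks the inequality; and \<rho> = 0 at
    w1 = 0, which excludes that hyperplane.\<close>
  define \<rho> :: "complex ^ 4 \<Rightarrow> real" where "\<rho> w = cmod (w $ 1) ^ (2 * k) * (1 - (cmod (w $ 1))\<^sup>2)" for w
  define C :: "(complex ^ 4) set" where "C = {w. (cmod (w $ 2))\<^sup>2 \<le> \<rho> w
    \<and> cmod (w $ 3) \<le> 1 \<and> cmod (w $ 4) \<le> 1}"
  have D2: "w \<in> D2 k \<longleftrightarrow> (cmod (w $ 2))\<^sup>2 < \<rho> w \<and> cmod (w $ 3) < 1 \<and> cmod (w $ 4) < 1" for w
  proof (cases "w $ 1 = 0")
    case True
    then have "\<rho> w = 0" using zero_power[of "2 * k", where 'a = real] k by (simp add: \<rho>_def)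
    then show ?thesis using True zero_le_power2[of "cmod (w $ 2)"] by (simp add: D2_eq_shear del: zero_le_power2)
  next
    case False
    then have pos: "cmod (w $ 1) ^ (2 * k) > 0" by simp
    have "(cmod (w $ 2 / w $ 1 ^ k))\<^sup>2 = (cmod (w $ 2))\<^sup>2 / cmod (w $ 1) ^ (2 * k)"
      by (simp add: norm_divide norm_power power_divide mult.commute flip: power_mult)
    then have "(cmod (w $ 1))\<^sup>2 + (cmod (w $ 2 / w $ 1 ^ k))\<^sup>2 < 1
        \<longleftrightarrow> (cmod (w $ 2))\<^sup>2 / cmod (w $ 1) ^ (2 * k) < 1 - (cmod (w $ 1))\<^sup>2" by linarith
    then have "(cmod (w $ 1))\<^sup>2 + (cmod (w $ 2 / w $ 1 ^ k))\<^sup>2 < 1 \<longleftrightarrow> (cmod (w $ 2))\<^sup>2 < \<rho> w"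
      unfolding pos_divide_less_eq[OF pos] \<rho>_def by (simp only: mult.commute)
    then show ?thesis
      using False by (simp add: D2_eq_shear ball_times_bidisc_def)
  qed
  show "closed C" unfolding C_def \<rho>_def
    by (intro closed_Collect_conj closed_Collect_le continuous_intros)
  show "D2 k \<subseteq> C" by (auto simp: D2 C_def)
  show "\<exists>j. \<forall>\<zeta>. cmod (z $ j) < cmod \<zeta> \<longrightarrow> upd z j \<zeta> \<notin> C" if z: "z \<in> C" "z \<notin> D2 k" for z
  proof -
    consider "(cmod (z $ 2))\<^sup>2 \<ge> \<rho> z" | "cmod (z $ 3) \<ge> 1" | "cmod (z $ 4) \<ge> 1"
      using z(2) unfolding D2 by linarith
    then show ?thesis
    proof cases
      case 1
      have "upd z 2 \<zeta> \<notin> C" if "cmod (z $ 2) < cmod \<zeta>" for \<zeta>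
      proof -
        have "(cmod (z $ 2))\<^sup>2 < (cmod \<zeta>)\<^sup>2" using that by (intro power_strict_mono) auto
        then show ?thesis using 1 by (simp add: C_def \<rho>_def)
      qed
      then show ?thesis by blast
    next
      case 2
      then show ?thesis by (intro exI[of _ 3]) (auto simp: C_def)
    next
      case 3
      then show ?thesis by (intro exI[of _ 4]) (auto simp: C_def)
    qed
  qed
qed

theorem mainTheorem4:
  fixes k m :: nat and p :: real
  assumes "k \<ge> 1" and "m \<ge> 1"
    and "p = 2 * real k / real m"
    and "\<not> (\<exists>j::int. p = 2 * of_int j)"
    and "p > 2"
  shows "bounded_domain_Cn (D1 k) \<and> Ap_complete p (D1 k) \<and>
         bounded_domain_Cn (D2 k) \<and> Ap_complete p (D2 k) \<and>
         (\<exists>T. Ap_isometry p (D1 k) (D2 k) T) \<and>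
         \<not> biholomorphic (D1 k) (D2 k)"
proof (intro conjI)
  show D1: "bounded_domain_Cn (D1 k)" unfolding D1_eq_shear by (rule bounded_domain_shear) simp
  show D2: "bounded_domain_Cn (D2 k)" unfolding D2_eq_shear by (rule bounded_domain_shear) simp
  show "Ap_complete p (D1 k)"
    using D1 interior_closure_D1[OF assms(1)] assms(5)
    by (intro Ap_complete_if_interior_closure) (auto simp: bounded_domain_Cn_def domain_Cn_def)
  show "Ap_complete p (D2 k)"
    using D2 interior_closure_D2[OF assms(1)] assms(5)
    by (intro Ap_complete_if_interior_closure) (auto simp: bounded_domain_Cn_def domain_Cn_def)
  have pm: "p * real m = 2 * real k" using assms(2,3) by simp
  obtain T1 where T1: "Ap_isometry p ball_times_bidisc (D1 k) T1"
    using shear_isometry(1)[OF open_ball_times_bidisc, of 3 4 p m k] assms(5) pm unfolding D1_eq_shear by auto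
  obtain T2 where T2: "Ap_isometry p ball_times_bidisc (D2 k) T2"
    using shear_isometry(1)[OF open_ball_times_bidisc, of 1 2 p m k] assms(5) pm unfolding D2_eq_shear by auto
  show "\<exists>T. Ap_isometry p (D1 k) (D2 k) T"
    using Ap_isometry_compose[OF Ap_isometry_inv_into[OF T1 open_ball_times_bidisc] T2] assms(5) by auto
  show "\<not> biholomorphic (D1 k) (D2 k)"
  proof
    assume bi: "biholomorphic (D1 k) (D2 k)"
    \<comment> \<open>The shears are invertible off their hyperplanes, so k disappears: the question
      is only which hyperplane, {z3 = 0} or {z1 = 0}, has been removed from the same
      product.\<close>
    have "biholomorphic (ball_times_bidisc \<inter> {z. z $ 3 \<noteq> 0}) (D1 k)"
      unfolding D1_eq_shear by (rule shear_biholomorphic) simp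
    moreover have "biholomorphic (D2 k) (ball_times_bidisc \<inter> {z. z $ 1 \<noteq> 0})"
      unfolding D2_eq_shear by (rule biholomorphic_sym[OF shear_biholomorphic]) simp
    ultimately show False
      using bi biholomorphic_trans not_biholomorphic_punctured by blast
  qed
qed

end
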